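(* Let $\mathbb{D}\subset\mathbb{C}$ be a simply connected domain with coordinate $z$, let $f : \mathbb{D} \to Q_{2}^{*}$ be a conformal Lagrangian immersion with a horizontal lift $\mathfrak{f}$ and induced metric $2e^u\,\mathrm{d}z\,\mathrm{d}\bar z$, and let $\alpha=\langle\mathfrak{f}_z,\mathfrak{f}_z\rangle$, $\beta=\langle\mathfrak{f}_z,\mathfrak{f}_{\bar z}\rangle$. Assume $e^{2u}-\alpha\bar\alpha>0$ on $\mathbb{D}$. Let $\mathcal{F}$ be the frame of $f$ given in the context, $\omega=\mathcal{F}^{-1}\mathrm{d}\mathcal{F}$, and for $\lambda\in\mathbb{S}^1$ let $$\omega^{\lambda}=\lambda^{-1}\omega_{\mathfrak p}'+\omega_{\mathfrak k}+\lambda\,\omega_{\mathfrak p}''.$$ Then the following statements are equivalent: (1) The Lagrangian immersion $f$ is minimal. (2) The connections $\mathrm{d}+\omega^{\lambda}$ are flat for all $\lambda\in\mathbb{S}^1$, i.e. $\mathrm{d}\omega^\lambda+\frac12[\omega^\lambda\wedge\omega^\lambda]=0$ for all $\lambda\in\mathbb{S}^1$. (3) The quadratic differential $\alpha\,\mathrm{d}z^2$ is holomorphic and $\varphi=\arg(\beta)$ is constant.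
   Context: On $\mathbb{C}^4_2=\mathbb{C}^4$ let $\langle \boldsymbol z,\boldsymbol w\rangle=-z_1w_1-z_2w_2+z_3w_3+z_4w_4$ (complex bilinear) and let $(\boldsymbol z,\boldsymbol w)=\langle \boldsymbol z,\overline{\boldsymbol w}\rangle$ be the indefinite Hermitian form. Put $\mathbb{H}^7_3(-1)=\{\boldsymbol z : (\boldsymbol z,\boldsymbol z)=-1\}$ and $\mathbb{CH}^3_1=\{[\boldsymbol z]\in\mathbb{C}P^3 : (\boldsymbol z,\boldsymbol z)<0\}$. The indefinite Hopf fibration $\pi:\mathbb{H}^7_3(-1)\to\mathbb{CH}^3_1$ is a pseudo-Riemannian submersion (with respect to $\mathrm{Re}(\cdot,\cdot)$), which defines the indefinite Kähler structure of $\mathbb{CH}^3_1$. $Q_2^*$ is a fixed connected component of $\{[\boldsymbol z]\in\mathbb{CH}^3_1 : \langle \boldsymbol z,\boldsymbol z\rangle=0\}$ with the induced Kähler structure (its metric is positive definite). An immersion $f$ of a surface into $Q_2^*$ is Lagrangian if the Kähler form pulls back to $0$, and minimal if its mean curvature vector in $Q_2^*$ vanishes. A horizontal lift of $f$ is a smooth $\mathfrak{f}:\mathbb{D}\to\mathbb{H}^7_3(-1)$ with $\pi\circ\mathfrak{f}=f$ and $\langle \mathfrak{f}_z,\overline{\mathfrak{f}}\rangle=\langle \mathfrak{f}_{\bar z},\overline{\mathfrak{f}}\rangle=0$; it is unique up to a constant unitary factor, and it satisfies $\langle\mathfrak f_z,\overline{\mathfrak f_z}\rangle=\langle\mathfrak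 f_{\bar z},\overline{\mathfrak f_{\bar z}}\rangle=e^u$, $\langle\mathfrak f_z,\overline{\mathfrak f_{\bar z}}\rangle=0$, $\langle\mathfrak f,\mathfrak f\rangle=\langle\mathfrak f_z,\mathfrak f\rangle=\langle\mathfrak f_{\bar z},\mathfrak f\rangle=0$. One has $|\beta|^2=e^{2u}-|\alpha|^2$. The frame of $f$ is the real $4\times4$-matrix valued map with columns $$\mathcal{F}=\left(\tfrac{1}{\sqrt2}(\mathfrak f+\bar{\mathfrak f}),\ -\tfrac{i}{\sqrt2}(\mathfrak f-\bar{\mathfrak f}),\ \tfrac{\mathfrak f_z+\overline{\mathfrak f_z}}{\sqrt{2e^u+\alpha+\bar\alpha}},\ -\tfrac{i\{\mathfrak f_z(e^u+\bar\alpha)-\overline{\mathfrak f_z}(e^u+\alpha)\}}{\sqrt{(2e^u+\alpha+\bar\alpha)(e^{2u}-\alpha\bar\alpha)}}\right),$$ which satisfies $\mathcal F^T\eta\mathcal F=\eta$ with $\eta=\mathrm{diag}(-1,-1,1,1)$ (one normalizes $\mathcal F(z_0)=\mathrm{Id}$ at a base point by an ambient isometry, which does not change $\omega$). Thus $\omega$ takes values in $\mathfrak{so}(2,2)=\mathfrak k\oplus\mathfrak p$, where $\mathfrak k=\mathfrak{so}(2)\times\mathfrak{so}(2)$ (block-diagonal matrices with $2\times2$ blocks) and $\mathfrak p$ (block off-diagonal matrices) are the $\pm1$-eigenspaces of $\mathrm{Ad}\,\mathrm{diag}(1,1,-1,-1)$; $\omega_{\mathfrak k},\omega_{\mathfrak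 p}$ are the corresponding components of $\omega$, and ${}'$, ${}''$ denote the $(1,0)$- and $(0,1)$-parts with respect to $z$. *)

theory Defs
  imports "HOL-Analysis.Analysis"
begin

section \<open>Calculus on domains of the complex plane\<close>

text \<open>Real directional derivative at \<open>p\<close> in the direction \<open>a\<close>; the tangent vectors
  \<open>\<partial>\<^sub>x\<close> and \<open>\<partial>\<^sub>y\<close> of the plane are \<open>1\<close> and \<open>\<i>\<close>.\<close>
definition pd :: "(complex \<Rightarrow> 'a::real_normed_vector) \<Rightarrow> complex \<Rightarrow> complex \<Rightarrow> 'a" where
  "pd F a p = frechet_derivative F (at p) a"

primrec Ck_on :: "nat \<Rightarrow> complex set \<Rightarrow> (complex \<Rightarrow> 'a::real_normed_vector) \<Rightarrow> bool" where
  "Ck_on 0 D F \<longleftrightarrow> continuous_on D F"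
| "Ck_on (Suc k) D F \<longleftrightarrow>
     (\<forall>p\<in>D. F differentiable at p) \<and> Ck_on k D (pd F 1) \<and> Ck_on k D (pd F \<i>)"

definition smooth_on :: "complex set \<Rightarrow> (complex \<Rightarrow> 'a::real_normed_vector) \<Rightarrow> bool" where
  "smooth_on D F \<longleftrightarrow> (\<forall>k. Ck_on k D F)"

definition wirt_z :: "(complex \<Rightarrow> complex^'n) \<Rightarrow> complex \<Rightarrow> complex^'n" where
  "wirt_z F p = (1/2) *s (pd F 1 p - \<i> *s pd F \<i> p)"

definition wirt_zbar :: "(complex \<Rightarrow> complex^'n) \<Rightarrow> complex \<Rightarrow> complex^'n" where
  "wirt_zbar F p = (1/2) *s (pd F 1 p + \<i> *s pd F \<i> p)"

section \<open>The indefinite complex hyperbolic space and the quadric\<close>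

definition bil :: "complex^4 \<Rightarrow> complex^4 \<Rightarrow> complex" where
  "bil z w = - z$1 * w$1 - z$2 * w$2 + z$3 * w$3 + z$4 * w$4"

definition vcnj :: "complex^'n \<Rightarrow> complex^'n" where
  "vcnj z = (\<chi> i. cnj (z$i))"

definition herm :: "complex^4 \<Rightarrow> complex^4 \<Rightarrow> complex" where
  "herm z w = bil z (vcnj w)"

definition H73 :: "(complex^4) set" where
  "H73 = {z. herm z z = -1}"

text \<open>A point of complex projective space is a complex line without its origin.\<close>
definition proj_class :: "complex^4 \<Rightarrow> (complex^4) set" where
  "proj_class z = {c *s z | c. c \<noteq> 0}"

definition CP3 :: "(complex^4) set set" where
  "CP3 = proj_class ` (UNIV - {0})"

text \<open>The quotient topology.\<close>
definition CP3_topology :: "(complex^4) set topology" where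
  "CP3_topology = topology (\<lambda>U. U \<subseteq> CP3 \<and> open {z. z \<noteq> 0 \<and> proj_class z \<in> U})"

lemma openin_CP3_topology:
  "openin CP3_topology U \<longleftrightarrow> U \<subseteq> CP3 \<and> open {z. z \<noteq> 0 \<and> proj_class z \<in> U}"
proof -
  have "istopology (\<lambda>U. U \<subseteq> CP3 \<and> open {z. z \<noteq> 0 \<and> proj_class z \<in> U})"
    unfolding istopology_def
  proof (intro conjI allI impI)
    fix S T
    assume S: "S \<subseteq> CP3 \<and> open {z. z \<noteq> 0 \<and> proj_class z \<in> S}"
      and T: "T \<subseteq> CP3 \<and> open {z. z \<noteq> 0 \<and> proj_class z \<in> T}"
    show "S \<inter> T \<subseteq> CP3" using S by blast
    have "{z. z \<noteq> 0 \<and> proj_class z \<in> S \<inter> T}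
        = {z. z \<noteq> 0 \<and> proj_class z \<in> S} \<inter> {z. z \<noteq> 0 \<and> proj_class z \<in> T}" by blast
    then show "open {z. z \<noteq> 0 \<and> proj_class z \<in> S \<inter> T}" using S T by (simp add: open_Int)
  next
    fix K
    assume K: "\<forall>S\<in>K. S \<subseteq> CP3 \<and> open {z. z \<noteq> 0 \<and> proj_class z \<in> S}"
    show "\<Union>K \<subseteq> CP3" using K by blast
    have "{z. z \<noteq> 0 \<and> proj_class z \<in> \<Union>K} = (\<Union>S\<in>K. {z. z \<noteq> 0 \<and> proj_class z \<in> S})" by blast
    then show "open {z. z \<noteq> 0 \<and> proj_class z \<in> \<Union>K}" using K by (simp add: open_UN)
  qed
  then show ?thesis unfolding CP3_topology_def by (simp add: topology_inverse')
qed

definition CH31 :: "(complex^4) set set" where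
  "CH31 = {proj_class z | z. Re (herm z z) < 0}"

definition null_quadric :: "(complex^4) set set" where
  "null_quadric = {proj_class z | z. Re (herm z z) < 0 \<and> bil z z = 0}"

text \<open>\<open>Q\<close> is one of the connected components of the quadric.\<close>
definition is_Q2star :: "(complex^4) set set \<Rightarrow> bool" where
  "is_Q2star Q \<longleftrightarrow> Q \<in> connected_components_of (subtopology CP3_topology null_quadric)"

subsection \<open>The affine chart\<close>

text \<open>The affine chart \<open>z\<^sub>1 \<noteq> 0\<close> of complex projective space is used for all differential geometry.
  It contains the whole quadric, see \<open>null_quadric_in_chart\<close> below.\<close>

definition homog :: "complex^3 \<Rightarrow> complex^4" where
  "homog x = (\<chi> i. if i = 1 then 1 else if i = 2 then x$1 else if i = 3 then x$2 else x$3)"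

definition homog0 :: "complex^3 \<Rightarrow> complex^4" where
  "homog0 v = (\<chi> i. if i = 1 then 0 else if i = 2 then v$1 else if i = 3 then v$2 else v$3)"

definition dehomog :: "complex^4 \<Rightarrow> complex^3" where
  "dehomog z = (\<chi> i. if i = 1 then z$2 / z$1 else if i = 2 then z$3 / z$1 else z$4 / z$1)"

definition chart :: "(complex^4) set \<Rightarrow> complex^3" where
  "chart L = (THE x. homog x \<in> L)"

lemma homog_nth [simp]:
  "homog x $ 1 = 1" "homog x $ 2 = x$1" "homog x $ 3 = x$2" "homog x $ 4 = x$3"
  by (simp_all add: homog_def)

lemma homog0_nth [simp]:
  "homog0 x $ 1 = 0" "homog0 x $ 2 = x$1" "homog0 x $ 3 = x$2" "homog0 x $ 4 = x$3"
  by (simp_all add: homog0_def)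

lemma dehomog_nth [simp]:
  "dehomog z $ 1 = z$2 / z$1" "dehomog z $ 2 = z$3 / z$1" "dehomog z $ 3 = z$4 / z$1"
  by (simp_all add: dehomog_def)

lemma chart_proj_class:
  assumes "z$1 \<noteq> 0"
  shows "chart (proj_class z) = dehomog z"
  unfolding chart_def
proof (rule the_equality)
  have "homog (dehomog z) = (1 / z$1) *s z"
    using assms by (simp add: vec_eq_iff forall_4)
  then show "homog (dehomog z) \<in> proj_class z"
    using assms unfolding proj_class_def by force
next
  fix x assume "homog x \<in> proj_class z"
  then obtain c where c: "homog x = c *s z" unfolding proj_class_def by blast
  have "1 = c * z$1" "x$1 = c * z$2" "x$2 = c * z$3" "x$3 = c * z$4"
    using arg_cong[OF c, of "\<lambda>v. v $ 1"] arg_cong[OF c, of "\<lambda>v. v $ 2"]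
      arg_cong[OF c, of "\<lambda>v. v $ 3"] arg_cong[OF c, of "\<lambda>v. v $ 4"] by simp_all
  then have "x$1 = z$2 / z$1" "x$2 = z$3 / z$1" "x$3 = z$4 / z$1"
    using assms by (simp_all add: field_simps)
  then show "x = dehomog z" by (simp add: vec_eq_iff forall_3)
qed

lemma null_quadric_in_chart:
  assumes "Re (herm z z) < 0" "bil z z = 0"
  shows "z$1 \<noteq> 0"
proof
  assume 0: "z$1 = 0"
  have a: "(z$2)^2 = (z$3)^2 + (z$4)^2"
    using assms(2) 0 unfolding bil_def by (simp add: power2_eq_square algebra_simps)
  have "(cmod (z$2))^2 = cmod ((z$3)^2 + (z$4)^2)"
    by (metis a norm_power)
  also have "\<dots> \<le> (cmod (z$3))^2 + (cmod (z$4))^2"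
    by (metis norm_power norm_triangle_ineq)
  finally show False
    using assms(1) 0 unfolding herm_def bil_def vcnj_def
    by (simp add: cmod_power2) (simp add: power2_eq_square)
qed

subsection \<open>The indefinite Kaehler structure\<close>

text \<open>The point of \<open>H73\<close> over the chart point \<open>x\<close> whose first coordinate is positive.\<close>
definition unit_lift :: "complex^3 \<Rightarrow> complex^4" where
  "unit_lift x = complex_of_real (1 / sqrt (- Re (herm (homog x) (homog x)))) *s homog x"

text \<open>The horizontal lift to \<open>z \<in> H73\<close> of the tangent vector \<open>v\<close> given in the chart; it is
  characterised by the two lemmas that follow.\<close>
definition hor_vec :: "complex^4 \<Rightarrow> complex^3 \<Rightarrow> complex^4" where
  "hor_vec z v = z$1 *s homog0 v + (z$1 * herm (homog0 v) z) *s z"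

lemma hor_vec_horizontal:
  assumes "z \<in> H73"
  shows "herm (hor_vec z v) z = 0"
proof -
  have "herm (hor_vec z v) z = z$1 * herm (homog0 v) z * (1 + herm z z)"
    unfolding hor_vec_def herm_def bil_def by (simp add: algebra_simps)
  then show ?thesis using assms by (simp add: H73_def)
qed

lemma hor_vec_projects:
  assumes "z$1 \<noteq> 0"
  shows "((\<lambda>t. dehomog (z + t *\<^sub>R hor_vec z v)) has_vector_derivative v) (at 0)"
proof -
  define w where "w = hor_vec z v"
  have d: "((\<lambda>t::real. (z$j + t *\<^sub>R w$j) / (z$1 + t *\<^sub>R w$1)) has_vector_derivative
      ((w$j * z$1 - z$j * w$1) / (z$1 * z$1))) (at 0)" for j
  proof -
    have "((\<lambda>t::complex. (z$j + t * w$j) / (z$1 + t * w$1)) has_field_derivative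
      ((w$j * z$1 - z$j * w$1) / (z$1 * z$1))) (at (of_real 0))"
      using assms by (auto intro!: derivative_eq_intros)
    from has_vector_derivative_real_field[OF this]
    show ?thesis by (simp add: scaleR_conv_of_real)
  qed
  have w: "(w$2 * z$1 - z$2 * w$1) / (z$1 * z$1) = v$1"
    "(w$3 * z$1 - z$3 * w$1) / (z$1 * z$1) = v$2"
    "(w$4 * z$1 - z$4 * w$1) / (z$1 * z$1) = v$3"
    using assms unfolding w_def hor_vec_def by (simp_all add: field_simps)
  have "((\<lambda>t. dehomog (z + t *\<^sub>R w) $ k) has_vector_derivative v $ k) (at 0)" for k
    using exhaust_3[of k] d[of 2] d[of 3] d[of 4] w by auto
  then have comp: "((\<lambda>t. dehomog (z + t *\<^sub>R w) $ k) has_derivative (\<lambda>t. t *\<^sub>R v $ k)) (at 0)" for k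
    by (simp add: has_vector_derivative_def)
  have "((\<lambda>t. dehomog (z + t *\<^sub>R w) \<bullet> b) has_derivative (\<lambda>t. (t *\<^sub>R v) \<bullet> b)) (at 0)"
    if "b \<in> Basis" for b :: "complex^3"
  proof -
    obtain k c where b: "b = axis k c" using \<open>b \<in> Basis\<close> unfolding Basis_vec_def by blast
    show ?thesis
      using has_derivative_inner_left[OF comp[of k], of c] by (simp add: b inner_axis)
  qed
  then have "((\<lambda>t. dehomog (z + t *\<^sub>R w)) has_derivative (\<lambda>t. t *\<^sub>R v)) (at 0)"
    by (subst has_derivative_componentwise_within) blast
  then show ?thesis unfolding w_def has_vector_derivative_def .
qed

text \<open>The metric making the Hopf fibration a pseudo-Riemannian submersion with respect to
  \<open>Re (herm _ _)\<close>, read in the chart.\<close>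
definition ch_metric :: "complex^3 \<Rightarrow> complex^3 \<Rightarrow> complex^3 \<Rightarrow> real" where
  "ch_metric x v w = Re (herm (hor_vec (unit_lift x) v) (hor_vec (unit_lift x) w))"

definition kaehler_form :: "complex^3 \<Rightarrow> complex^3 \<Rightarrow> complex^3 \<Rightarrow> real" where
  "kaehler_form x v w = ch_metric x (\<i> *s v) w"

text \<open>The Levi-Civita connection of a metric \<open>g\<close> in a chart: \<open>christoffel g x v w\<close> is the covariant
  derivative at \<open>x\<close> of the constant field \<open>w\<close> along \<open>v\<close>, given by the Koszul formula (the brackets
  of constant fields vanish).\<close>
definition christoffel ::
    "('a::real_normed_vector \<Rightarrow> 'a \<Rightarrow> 'a \<Rightarrow> real) \<Rightarrow> 'a \<Rightarrow> 'a \<Rightarrow> 'a \<Rightarrow> 'a" where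
  "christoffel g x v w = (THE c. \<forall>k. 2 * g x c k =
      frechet_derivative (\<lambda>y. g y w k) (at x) v
    + frechet_derivative (\<lambda>y. g y v k) (at x) w
    - frechet_derivative (\<lambda>y. g y v w) (at x) k)"

text \<open>The tangent space of the quadric in the chart.\<close>
definition quadric_tangent :: "complex^3 \<Rightarrow> (complex^3) set" where
  "quadric_tangent x = {v. frechet_derivative (\<lambda>y. bil (homog y) (homog y)) (at x) v = 0}"

section \<open>Surfaces in the quadric\<close>

type_synonym surface = "complex \<Rightarrow> (complex^4) set"

definition tangent_map :: "surface \<Rightarrow> complex \<Rightarrow> complex \<Rightarrow> complex^3" where
  "tangent_map f p a = pd (chart \<circ> f) a p"

definition immersion_on :: "complex set \<Rightarrow> surface \<Rightarrow> bool" where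
  "immersion_on D f \<longleftrightarrow> smooth_on D (chart \<circ> f) \<and> (\<forall>p\<in>D. inj (tangent_map f p))"

definition first_ff :: "surface \<Rightarrow> complex \<Rightarrow> complex \<Rightarrow> complex \<Rightarrow> real" where
  "first_ff f p a b = ch_metric (chart (f p)) (tangent_map f p a) (tangent_map f p b)"

text \<open>\<open>f\<close> is conformal with induced metric \<open>2 e\<^sup>u dz d\<open>zbar\<close> = 2 e\<^sup>u (dx\<^sup>2 + dy\<^sup>2)\<close>.\<close>
definition conformal_with :: "complex set \<Rightarrow> surface \<Rightarrow> (complex \<Rightarrow> real) \<Rightarrow> bool" where
  "conformal_with D f u \<longleftrightarrow> (\<forall>p\<in>D. \<forall>a b. first_ff f p a b = 2 * exp (u p) * (a \<bullet> b))"

definition lagrangian_on :: "complex set \<Rightarrow> surface \<Rightarrow> bool" where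
  "lagrangian_on D f \<longleftrightarrow>
     (\<forall>p\<in>D. \<forall>a b. kaehler_form (chart (f p)) (tangent_map f p a) (tangent_map f p b) = 0)"

definition normal_space :: "surface \<Rightarrow> complex \<Rightarrow> (complex^3) set" where
  "normal_space f p =
     {n \<in> quadric_tangent (chart (f p)). \<forall>a. ch_metric (chart (f p)) n (tangent_map f p a) = 0}"

text \<open>Orthogonal projection to the normal space of the surface in the quadric.\<close>
definition normal_part :: "surface \<Rightarrow> complex \<Rightarrow> complex^3 \<Rightarrow> complex^3" where
  "normal_part f p w = (THE n. n \<in> normal_space f p \<and>
     (\<forall>m \<in> normal_space f p. ch_metric (chart (f p)) n m = ch_metric (chart (f p)) w m))"

text \<open>The covariant derivative in \<open>CH31\<close>, along the surface and in the direction \<open>a\<close>, of the field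
  that is the image of the constant field \<open>b\<close>.\<close>
definition cov_deriv :: "surface \<Rightarrow> complex \<Rightarrow> complex \<Rightarrow> complex \<Rightarrow> complex^3" where
  "cov_deriv f p a b = pd (\<lambda>q. tangent_map f q b) a p
     + christoffel ch_metric (chart (f p)) (tangent_map f p a) (tangent_map f p b)"

text \<open>The Levi-Civita connection of the quadric is the tangential part of that of \<open>CH31\<close>, so
  the second fundamental form in the quadric is the following normal part.\<close>
definition second_ff :: "surface \<Rightarrow> complex \<Rightarrow> complex \<Rightarrow> complex \<Rightarrow> complex^3" where
  "second_ff f p a b = normal_part f p (cov_deriv f p a b)"

text \<open>Half the trace of the second fundamental form with respect to the induced metric.\<close>
definition mean_curvature :: "surface \<Rightarrow> complex \<Rightarrow> complex^3" where
  "mean_curvature f p =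
    (let E = first_ff f p 1 1; F = first_ff f p 1 \<i>; G = first_ff f p \<i> \<i>
     in (1 / (2 * (E * G - F\<^sup>2))) *\<^sub>R
        (G *\<^sub>R second_ff f p 1 1 - (2 * F) *\<^sub>R second_ff f p 1 \<i> + E *\<^sub>R second_ff f p \<i> \<i>))"

definition minimal_on :: "complex set \<Rightarrow> surface \<Rightarrow> bool" where
  "minimal_on D f \<longleftrightarrow> (\<forall>p\<in>D. mean_curvature f p = 0)"

section \<open>Horizontal lift, invariants and frame\<close>

definition horizontal_lift :: "complex set \<Rightarrow> surface \<Rightarrow> (complex \<Rightarrow> complex^4) \<Rightarrow> bool" where
  "horizontal_lift D f h \<longleftrightarrow> smooth_on D h \<and>
     (\<forall>p\<in>D. h p \<in> H73 \<and> proj_class (h p) = f p \<and>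
        bil (wirt_z h p) (vcnj (h p)) = 0 \<and> bil (wirt_zbar h p) (vcnj (h p)) = 0)"

definition alpha :: "(complex \<Rightarrow> complex^4) \<Rightarrow> complex \<Rightarrow> complex" where
  "alpha h p = bil (wirt_z h p) (wirt_z h p)"

definition beta :: "(complex \<Rightarrow> complex^4) \<Rightarrow> complex \<Rightarrow> complex" where
  "beta h p = bil (wirt_z h p) (wirt_zbar h p)"

text \<open>The frame has real entries; it is given complex type so that the \<open>(1,0)\<close>- and \<open>(0,1)\<close>-parts
  of its Maurer-Cartan form have the same type.\<close>
definition frame :: "(complex \<Rightarrow> real) \<Rightarrow> (complex \<Rightarrow> complex^4) \<Rightarrow> complex \<Rightarrow> complex^4^4" where
  "frame u h p =
    (let e = complex_of_real (exp (u p)); a = alpha h p; hz = wirt_z h p;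
         r = 2 * exp (u p) + 2 * Re a; s = exp (2 * u p) - (cmod a)\<^sup>2;
         c1 = complex_of_real (1 / sqrt 2) *s (h p + vcnj (h p));
         c2 = (- \<i> * complex_of_real (1 / sqrt 2)) *s (h p - vcnj (h p));
         c3 = complex_of_real (1 / sqrt r) *s (hz + vcnj hz);
         c4 = (- \<i> * complex_of_real (1 / sqrt (r * s))) *s
                ((e + cnj a) *s hz - (e + a) *s vcnj hz)
     in (\<chi> i j. if j = 1 then c1$i else if j = 2 then c2$i else if j = 3 then c3$i else c4$i))"

section \<open>Matrix-valued one-forms\<close>

type_synonym mform = "complex \<Rightarrow> complex \<Rightarrow> complex^4^4"

definition maurer_cartan :: "(complex \<Rightarrow> complex^4^4) \<Rightarrow> mform" where
  "maurer_cartan F p v = matrix_inv (F p) ** pd F v p"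

definition msc :: "complex \<Rightarrow> complex^4^4 \<Rightarrow> complex^4^4" where
  "msc c M = map_matrix ((*) c) M"

definition k_part :: "complex^4^4 \<Rightarrow> complex^4^4" where
  "k_part M = (\<chi> i j. if i \<in> {1,2} \<longleftrightarrow> j \<in> {1,2} then M$i$j else 0)"

definition p_part :: "complex^4^4 \<Rightarrow> complex^4^4" where
  "p_part M = (\<chi> i j. if i \<in> {1,2} \<longleftrightarrow> j \<in> {1,2} then 0 else M$i$j)"

definition form10 :: "mform \<Rightarrow> mform" where
  "form10 \<theta> p v = msc (1/2) (\<theta> p v - msc \<i> (\<theta> p (\<i> * v)))"

definition form01 :: "mform \<Rightarrow> mform" where
  "form01 \<theta> p v = msc (1/2) (\<theta> p v + msc \<i> (\<theta> p (\<i> * v)))"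

definition assoc_form :: "mform \<Rightarrow> complex \<Rightarrow> mform" where
  "assoc_form \<omega> l p v =
     msc (inverse l) (form10 (\<lambda>q w. p_part (\<omega> q w)) p v)
     + k_part (\<omega> p v)
     + msc l (form01 (\<lambda>q w. p_part (\<omega> q w)) p v)"

definition ext_d :: "mform \<Rightarrow> complex \<Rightarrow> complex \<Rightarrow> complex \<Rightarrow> complex^4^4" where
  "ext_d \<theta> p v w = pd (\<lambda>q. \<theta> q w) v p - pd (\<lambda>q. \<theta> q v) w p"

definition lie_bracket :: "complex^4^4 \<Rightarrow> complex^4^4 \<Rightarrow> complex^4^4" where
  "lie_bracket A B = A ** B - B ** A"

definition bracket_wedge :: "mform \<Rightarrow> mform \<Rightarrow> complex \<Rightarrow> complex \<Rightarrow> complex \<Rightarrow> complex^4^4" where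
  "bracket_wedge \<theta> \<eta> p v w = lie_bracket (\<theta> p v) (\<eta> p w) - lie_bracket (\<theta> p w) (\<eta> p v)"

definition flat_connection_on :: "complex set \<Rightarrow> mform \<Rightarrow> bool" where
  "flat_connection_on D \<theta> \<longleftrightarrow>
     (\<forall>p\<in>D. \<forall>v w. ext_d \<theta> p v w + msc (1/2) (bracket_wedge \<theta> \<theta> p v w) = 0)"

end

theory Submission
  imports Defs
begin

text \<open>All three conditions say that the component of \<open>h\<^sub>x\<^sub>x + h\<^sub>y\<^sub>y\<close> orthogonal to the plane
  \<open>W\<close> spanned by \<open>h\<close> and its conjugate vanishes; here \<open>h\<^sub>x\<close>, \<open>h\<^sub>y\<close> form a unitary basis, up to the
  factor \<open>2 e\<^sup>u\<close>, of the orthogonal complement of \<open>W\<close>.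
  The horizontal lift of the second fundamental form is the normal part of the second derivatives of
  \<open>h\<close>, and by conformality the tangential part of the Laplacian is zero: this is minimality.
  Flatness of the family amounts to harmonicity of the Gauss map \<open>W\<close>; since the derivatives of \<open>h\<close>
  and of its conjugate are orthogonal to \<open>W\<close>, these two vectors are parallel in the bundle \<open>W\<close>, and
  harmonicity reduces to the same condition.
  Finally the Gram determinant of \<open>h\<^sub>x\<close>, \<open>h\<^sub>y\<close> equals \<open>4 e\<^sup>2\<^sup>u \<beta>\<^sup>2 / \<bar>\<beta>\<bar>\<^sup>2\<close>, and its logarithmic
  derivative shows that the differential of the argument of \<open>\<beta>\<close> is, up to a factor, the pairing of the
  Laplacian with \<open>h\<^sub>x\<close>, \<open>h\<^sub>y\<close>. Holomorphicity of \<open>\<alpha>\<close> then comes for free.\<close>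

section \<open>Differentiation in the plane\<close>

text \<open>The delicate side is minimality: mean curvature is defined intrinsically in an affine
  chart, with the Christoffel symbols and the normal projection given by definite descriptions. Both
  are evaluated explicitly. Lifting horizontally turns the chart metric into the constant form
  \<open>herm\<close>, and a second derivative of \<open>h\<close> is the lift of the covariant
  derivative plus some multiple of \<open>h\<close>; the multiple stays implicit because
  \<open>h\<close> pairs to zero with the conjugates of h_x and h_y. The Lagrangian condition makes
  the normal space i times the tangent plane, so the second fundamental form records only imaginary
  parts of such pairings.

  The value of the Gram determinant is linear algebra: with E = 2 e^u, the complex symmetric Gram
  matrix S of h_x, h_y under \<open>bil\<close> satisfies S S^* = E^2, because these vectors and
  their conjugates span the same complement of W. So det S / E^2 is a phase. The bound on alpha
  makes beta nonzero; the phase then fixes the argument of beta up to pi, and connectedness removes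
  the ambiguity. The same bound keeps both radicands in the frame positive.\<close>

lemma pd_eqI:
  assumes "(F has_derivative F') (at p)"
  shows "pd F a p = F' a"
  using frechet_derivative_at[OF assms] by (simp add: pd_def)

lemma has_derivative_pd:
  assumes "F differentiable at p"
  shows "(F has_derivative (\<lambda>a. pd F a p)) (at p)"
  using assms unfolding pd_def frechet_derivative_works by (simp add: eta_contract_eq)

lemma pd_cong:
  assumes "open D" "p \<in> D" "\<And>q. q \<in> D \<Longrightarrow> F q = G q"
  shows "pd F a p = pd G a p"
proof -
  have "(F has_derivative F') (at p) \<longleftrightarrow> (G has_derivative F') (at p)" for F'
    using has_derivative_transform_within_open[OF _ assms(1,2), of F F' UNIV G]
      has_derivative_transform_within_open[OF _ assms(1,2), of G F' UNIV F] assms(3) by metis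
  then show ?thesis unfolding pd_def frechet_derivative_def by simp
qed

lemma differentiable_cong_open:
  assumes "open D" "p \<in> D" "\<And>q. q \<in> D \<Longrightarrow> F q = G q" "F differentiable at p"
  shows "G differentiable at p"
  using assms unfolding differentiable_def
  by (metis has_derivative_transform_within_open)

lemma pd_directions:
  assumes "F differentiable at p"
  shows "pd F v p = Re v *\<^sub>R pd F 1 p + Im v *\<^sub>R pd F \<i> p"
proof -
  interpret bounded_linear "\<lambda>a. pd F a p"
    using has_derivative_bounded_linear[OF has_derivative_pd[OF assms]] .
  have "v = Re v *\<^sub>R 1 + Im v *\<^sub>R \<i>" by (simp add: complex_eq_iff)
  then show ?thesis by (metis add scaleR)
qed

lemma
  assumes "bounded_linear L" "F differentiable at p"
  shows pd_bounded_linear: "pd (\<lambda>q. L (F q)) a p = L (pd F a p)"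
    and differentiable_bounded_linear: "(\<lambda>q. L (F q)) differentiable at p"
proof -
  have "((\<lambda>q. L (F q)) has_derivative (\<lambda>a. L (pd F a p))) (at p)"
    using bounded_linear.has_derivative[OF assms(1) has_derivative_pd[OF assms(2)]] .
  then show "pd (\<lambda>q. L (F q)) a p = L (pd F a p)" "(\<lambda>q. L (F q)) differentiable at p"
    by (auto simp: pd_eqI differentiable_def)
qed

lemma
  assumes "bounded_bilinear B" "F differentiable at p" "G differentiable at p"
  shows pd_bounded_bilinear: "pd (\<lambda>q. B (F q) (G q)) a p = B (pd F a p) (G p) + B (F p) (pd G a p)"
    and differentiable_bounded_bilinear: "(\<lambda>q. B (F q) (G q)) differentiable at p"
proof -
  have "((\<lambda>q. B (F q) (G q)) has_derivative (\<lambda>a. B (F p) (pd G a p) + B (pd F a p) (G p))) (at p)"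
    using bounded_bilinear.FDERIV[OF assms(1) has_derivative_pd[OF assms(2)] has_derivative_pd[OF assms(3)]] .
  then show "pd (\<lambda>q. B (F q) (G q)) a p = B (pd F a p) (G p) + B (F p) (pd G a p)"
    "(\<lambda>q. B (F q) (G q)) differentiable at p"
    by (auto simp: pd_eqI differentiable_def)
qed

lemma pd_add:
  assumes "F differentiable at p" "G differentiable at p"
  shows "pd (\<lambda>q. F q + G q) a p = pd F a p + pd G a p"
  using pd_eqI[OF has_derivative_add[OF has_derivative_pd[OF assms(1)] has_derivative_pd[OF assms(2)]]] .

lemma pd_const [simp]: "pd (\<lambda>q. c) a p = 0"
  by (simp add: pd_def)

section \<open>Stability of k-fold differentiability under sums, bilinear maps and inverse square
  roots\<close>

lemma Ck_on_cong:
  assumes "open D" "\<And>q. q \<in> D \<Longrightarrow> F q = G q" "Ck_on k D F"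
  shows "Ck_on k D G"
  using assms(2,3)
proof (induction k arbitrary: F G)
  case 0
  then show ?case using continuous_on_cong[of D D F G] by simp
next
  case (Suc k)
  then show ?case
    using differentiable_cong_open[OF assms(1), of _ F G] pd_cong[OF assms(1), of _ F G]
    by (metis Ck_on.simps(2))
qed

lemma Ck_on_continuous: "Ck_on k D F \<Longrightarrow> continuous_on D F"
  by (cases k) (auto intro!: continuous_at_imp_continuous_on differentiable_imp_continuous_within)

lemma Ck_on_Suc_D: "Ck_on (Suc k) D F \<Longrightarrow> Ck_on k D F"
proof (induction k arbitrary: F)
  case 0
  then show ?case using Ck_on_continuous[of "Suc 0"] by auto
next
  case (Suc k)
  have "Ck_on (Suc k) D (pd F 1)" "Ck_on (Suc k) D (pd F \<i>)"
    using Suc.prems by (simp_all only: Ck_on.simps(2)[of "Suc k"])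
  then have "Ck_on k D (pd F 1)" "Ck_on k D (pd F \<i>)" using Suc.IH by blast+
  then show ?case using Suc.prems by simp
qed

lemma Ck_on_bounded_linear:
  assumes "open D" "bounded_linear L" "Ck_on k D F"
  shows "Ck_on k D (\<lambda>q. L (F q))"
  using assms(3)
proof (induction k arbitrary: F)
  case 0
  then show ?case using bounded_linear.continuous_on[OF assms(2)] by simp
next
  case (Suc k)
  have "pd (\<lambda>q. L (F q)) a q = L (pd F a q)" if "q \<in> D" for q a
    using pd_bounded_linear[OF assms(2)] Suc.prems that by simp
  then show ?case
    using Suc.IH[of "pd F 1"] Suc.IH[of "pd F \<i>"] Suc.prems differentiable_bounded_linear[OF assms(2)]
    by (auto intro: Ck_on_cong[OF assms(1)])
qed

lemma Ck_on_add:
  assumes "open D" "Ck_on k D F" "Ck_on k D G"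
  shows "Ck_on k D (\<lambda>q. F q + G q)"
  using assms(2,3)
proof (induction k arbitrary: F G)
  case 0
  then show ?case by (simp add: continuous_on_add)
next
  case (Suc k)
  have "pd (\<lambda>q. F q + G q) a q = pd F a q + pd G a q" if "q \<in> D" for q a
    using Suc.prems that by (intro pd_add) auto
  then show ?case
    using Suc.IH[of "pd F 1" "pd G 1"] Suc.IH[of "pd F \<i>" "pd G \<i>"] Suc.prems
    by (auto intro: Ck_on_cong[OF assms(1)])
qed

lemma Ck_on_bounded_bilinear:
  assumes "open D" "bounded_bilinear B" "Ck_on k D F" "Ck_on k D G"
  shows "Ck_on k D (\<lambda>q. B (F q) (G q))"
  using assms(3,4)
proof (induction k arbitrary: F G)
  case 0
  then show ?case using bounded_bilinear.continuous_on[OF assms(2)] by simp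
next
  case (Suc k)
  have pd: "pd (\<lambda>q. B (F q) (G q)) a q = B (pd F a q) (G q) + B (F q) (pd G a q)" if "q \<in> D" for q a
    using pd_bounded_bilinear[OF assms(2)] Suc.prems that by simp
  have "Ck_on k D (\<lambda>q. B (pd F a q) (G q) + B (F q) (pd G a q))" if "a \<in> {1, \<i>}" for a
    using Suc.prems that Ck_on_Suc_D[of k D F] Ck_on_Suc_D[of k D G]
    by (intro Ck_on_add[OF assms(1)] Suc.IH) auto
  then show ?case
    using Suc.prems differentiable_bounded_bilinear[OF assms(2)] pd
    by (auto intro: Ck_on_cong[OF assms(1)])
qed

lemma Ck_on_const: "Ck_on k D (\<lambda>q. c)"
proof (induction k arbitrary: c)
  case (Suc k)
  have "pd (\<lambda>q. c) a = (\<lambda>q. 0)" for a by auto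
  then show ?case using Suc by simp
qed simp

lemma Ck_on_minus:
  assumes "open D" "Ck_on k D F"
  shows "Ck_on k D (\<lambda>q. - F q)"
  using Ck_on_bounded_linear[OF assms(1) bounded_linear_minus[OF bounded_linear_ident] assms(2)] .

lemma Ck_on_diff:
  assumes "open D" "Ck_on k D F" "Ck_on k D G"
  shows "Ck_on k D (\<lambda>q. F q - G q)"
  using Ck_on_add[OF assms(1,2) Ck_on_minus[OF assms(1,3)]] by simp

text \<open>The derivative of s = r^(-1/2) is -(1/2) s^3 r', a product in s itself and r', so the
  induction on the order closes without other powers of r.\<close>

lemma Ck_on_inverse_sqrt:
  fixes r :: "complex \<Rightarrow> real"
  assumes "open D" "Ck_on k D r" "\<And>q. q \<in> D \<Longrightarrow> r q > 0"
  shows "Ck_on k D (\<lambda>q. 1 / sqrt (r q))"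
  using assms(2)
proof (induction k)
  case 0
  then show ?case using assms(3) by (fastforce intro!: continuous_intros)
next
  case (Suc k)
  define s where "s q = 1 / sqrt (r q)" for q
  have der: "(s has_derivative (\<lambda>a. - (1/2) * (s q * (s q * s q)) * pd r a q)) (at q)" if "q \<in> D" for q
  proof -
    have "r q > 0" "r differentiable at q" using assms(3) Suc.prems that by auto
    then have d: "((\<lambda>q. 1 / sqrt (r q)) has_derivative
      (\<lambda>a. - (pd r a q * (inverse (sqrt (r q)) / 2)) / (sqrt (r q) * sqrt (r q)))) (at q)"
      by (auto intro!: derivative_eq_intros has_derivative_pd simp: divide_simps)
    show ?thesis unfolding s_def
      by (rule has_derivative_eq_rhs[OF d]) (auto simp: field_simps fun_eq_iff)
  qed
  have IH: "Ck_on k D s" using Suc Ck_on_Suc_D unfolding s_def by blast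
  have "Ck_on k D (pd s a)" if "a \<in> {1, \<i>}" for a
  proof (rule Ck_on_cong[OF assms(1)])
    show "- (1/2) * (s q * (s q * s q)) * pd r a q = pd s a q" if "q \<in> D" for q
      using pd_eqI[OF der[OF that]] by simp
    show "Ck_on k D (\<lambda>q. - (1/2) * (s q * (s q * s q)) * pd r a q)"
      using Suc.prems that
      by (intro Ck_on_bounded_bilinear[OF assms(1) bounded_bilinear_mult] IH Ck_on_const) auto
  qed
  moreover have "s differentiable at q" if "q \<in> D" for q using der[OF that] differentiable_def by blast
  ultimately have "Ck_on (Suc k) D s" by simp
  then show ?case unfolding s_def .
qed

section \<open>Symmetry of second derivatives\<close>

text \<open>Two applications of the one-variable mean value theorem: along a to the increment in the
  direction b, then along b to the derivative in the direction a. Unit length of a and b keeps the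
  parallelogram within distance 2t of p.\<close>

lemma second_difference_mvt:
  fixes F :: "complex \<Rightarrow> real"
  assumes D: "\<And>q. dist p q \<le> 2 * t \<Longrightarrow> F differentiable at q"
    and D': "\<And>q. dist p q \<le> 2 * t \<Longrightarrow> pd F a differentiable at q"
    and t: "t > 0" and ab: "cmod a = 1" "cmod b = 1"
  obtains q where "dist p q \<le> 2 * t"
    "F (p + t *\<^sub>R a + t *\<^sub>R b) - F (p + t *\<^sub>R a) - F (p + t *\<^sub>R b) + F p = t^2 * pd (pd F a) b q"
proof -
  have near: "dist p (p + s *\<^sub>R a + s' *\<^sub>R b) \<le> 2 * t" if "0 \<le> s" "s \<le> t" "0 \<le> s'" "s' \<le> t" for s s'
  proof -
    have "dist p (p + s *\<^sub>R a + s' *\<^sub>R b) = norm (s *\<^sub>R a + s' *\<^sub>R b)"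
      by (metis add.assoc add_diff_cancel_left' dist_commute dist_norm)
    also have "\<dots> \<le> norm (s *\<^sub>R a) + norm (s' *\<^sub>R b)" by (rule norm_triangle_ineq)
    finally show ?thesis using ab that by simp
  qed
  have line: "((\<lambda>s. G (q + s *\<^sub>R c)) has_real_derivative pd G c (q + s *\<^sub>R c)) (at s)"
    if "G differentiable at (q + s *\<^sub>R c)" for G :: "complex \<Rightarrow> real" and q c s
  proof -
    have "((\<lambda>s. q + s *\<^sub>R c) has_derivative (\<lambda>h. h *\<^sub>R c)) (at s)"
      by (auto intro!: derivative_eq_intros)
    from diff_chain_at[OF this has_derivative_pd[OF that]]
    have "((\<lambda>s. G (q + s *\<^sub>R c)) has_derivative (\<lambda>h. pd G (h *\<^sub>R c) (q + s *\<^sub>R c))) (at s)"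
      by (simp add: o_def)
    moreover have "pd G (h *\<^sub>R c) (q + s *\<^sub>R c) = pd G c (q + s *\<^sub>R c) * h" for h
      using linear_simps(5)[OF has_derivative_bounded_linear[OF has_derivative_pd[OF that]]] by simp
    ultimately show ?thesis by (simp add: has_field_derivative_def)
  qed
  define g where "g s = F (p + t *\<^sub>R b + s *\<^sub>R a) - F (p + s *\<^sub>R a)" for s
  have "\<exists>z. 0 < z \<and> z < t \<and> g t - g 0 = (t - 0) * (pd F a (p + t *\<^sub>R b + z *\<^sub>R a) - pd F a (p + z *\<^sub>R a))"
    unfolding g_def
  proof (rule MVT2[OF t])
    fix s assume s: "0 \<le> s" "s \<le> t"
    show "((\<lambda>s. F (p + t *\<^sub>R b + s *\<^sub>R a) - F (p + s *\<^sub>R a)) has_real_derivative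
        pd F a (p + t *\<^sub>R b + s *\<^sub>R a) - pd F a (p + s *\<^sub>R a)) (at s)"
      using near[OF s, of t] near[OF s, of 0] t
      by (intro DERIV_diff line D) (auto simp: algebra_simps)
  qed
  then obtain s where s: "0 < s" "s < t"
    "g t - g 0 = t * (pd F a (p + s *\<^sub>R a + t *\<^sub>R b) - pd F a (p + s *\<^sub>R a))"
    by (auto simp: algebra_simps)
  have "\<exists>z. 0 < z \<and> z < t \<and> pd F a (p + s *\<^sub>R a + t *\<^sub>R b) - pd F a (p + s *\<^sub>R a + 0 *\<^sub>R b)
      = (t - 0) * pd (pd F a) b (p + s *\<^sub>R a + z *\<^sub>R b)"
    using s near[of s] by (intro MVT2[OF t] line D') auto
  then obtain s' where s': "0 < s'" "s' < t" "pd F a (p + s *\<^sub>R a + t *\<^sub>R b) - pd F a (p + s *\<^sub>R a)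
      = t * pd (pd F a) b (p + s *\<^sub>R a + s' *\<^sub>R b)" by auto
  show thesis
  proof
    show "dist p (p + s *\<^sub>R a + s' *\<^sub>R b) \<le> 2 * t" using near s s' by simp
    show "F (p + t *\<^sub>R a + t *\<^sub>R b) - F (p + t *\<^sub>R a) - F (p + t *\<^sub>R b) + F p
        = t\<^sup>2 * pd (pd F a) b (p + s *\<^sub>R a + s' *\<^sub>R b)"
      using s(3) s'(3) by (simp add: g_def power2_eq_square algebra_simps)
  qed
qed

text \<open>The second difference is symmetric in the two directions, so the two mixed derivatives
  agree at some pair of points near p. By continuity they cannot differ at p.\<close>

lemma pd_commute_real:
  fixes F :: "complex \<Rightarrow> real"
  assumes D: "open D" "p \<in> D" and C: "Ck_on 2 D F"
  shows "pd (pd F 1) \<i> p = pd (pd F \<i>) 1 p"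
proof (rule ccontr)
  have C': "F differentiable at q" "pd F 1 differentiable at q" "pd F \<i> differentiable at q" if "q \<in> D" for q
    using C that by (auto simp: numeral_2_eq_2)
  have cont: "continuous_on D (pd (pd F 1) \<i>)" "continuous_on D (pd (pd F \<i>) 1)"
    using C by (auto simp: numeral_2_eq_2)
  define e where "e = dist (pd (pd F 1) \<i> p) (pd (pd F \<i>) 1 p) / 2"
  assume "pd (pd F 1) \<i> p \<noteq> pd (pd F \<i>) 1 p"
  then have "e > 0" by (simp add: e_def)
  obtain d0 where d0: "d0 > 0" "cball p d0 \<subseteq> D" using D open_contains_cball by blast
  obtain d1 where d1: "d1 > 0" "\<And>q. q \<in> D \<Longrightarrow> dist q p < d1 \<Longrightarrow> dist (pd (pd F 1) \<i> q) (pd (pd F 1) \<i> p) < e"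
    using cont(1) D \<open>e > 0\<close> unfolding continuous_on_iff by metis
  obtain d2 where d2: "d2 > 0" "\<And>q. q \<in> D \<Longrightarrow> dist q p < d2 \<Longrightarrow> dist (pd (pd F \<i>) 1 q) (pd (pd F \<i>) 1 p) < e"
    using cont(2) D \<open>e > 0\<close> unfolding continuous_on_iff by metis
  \<comment> \<open>Division by 3 leaves 2t strictly below all three radii.\<close>
  define t where "t = min d0 (min d1 d2) / 3"
  have t: "t > 0" "2 * t \<le> d0" "2 * t < d1" "2 * t < d2" using d0 d1 d2 by (auto simp: t_def min_def)
  have inD: "q \<in> D" if "dist p q \<le> 2 * t" for q using that d0 t by force
  obtain q where q: "dist p q \<le> 2 * t" "F (p + t *\<^sub>R 1 + t *\<^sub>R \<i>) - F (p + t *\<^sub>R 1) - F (p + t *\<^sub>R \<i>) + F p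
      = t^2 * pd (pd F 1) \<i> q"
    by (rule second_difference_mvt[of p t F 1 \<i>]) (use C' inD t in auto)
  obtain q' where q': "dist p q' \<le> 2 * t" "F (p + t *\<^sub>R \<i> + t *\<^sub>R 1) - F (p + t *\<^sub>R \<i>) - F (p + t *\<^sub>R 1) + F p
      = t^2 * pd (pd F \<i>) 1 q'"
    by (rule second_difference_mvt[of p t F \<i> 1]) (use C' inD t in auto)
  have "t^2 * pd (pd F 1) \<i> q = t^2 * pd (pd F \<i>) 1 q'"
    using q(2) q'(2) by (simp add: algebra_simps)
  then have "pd (pd F 1) \<i> q = pd (pd F \<i>) 1 q'" using t by simp
  moreover have "dist (pd (pd F 1) \<i> q) (pd (pd F 1) \<i> p) < e"
    using d1(2)[OF inD[OF q(1)]] q(1) t by (simp add: dist_commute)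
  moreover have "dist (pd (pd F \<i>) 1 q') (pd (pd F \<i>) 1 p) < e"
    using d2(2)[OF inD[OF q'(1)]] q'(1) t by (simp add: dist_commute)
  ultimately have "dist (pd (pd F 1) \<i> p) (pd (pd F \<i>) 1 p) < 2 * e"
    using dist_triangle_half_r[of "pd (pd F 1) \<i> q" _ "2 * e"] by simp
  then show False by (simp add: e_def)
qed

lemma pd_commute:
  fixes F :: "complex \<Rightarrow> 'a::euclidean_space"
  assumes "open D" "p \<in> D" "Ck_on 2 D F"
  shows "pd (pd F 1) \<i> p = pd (pd F \<i>) 1 p"
proof (rule euclidean_eqI)
  fix b :: 'a assume "b \<in> Basis"
  let ?F = "\<lambda>q. F q \<bullet> b"
  have d: "pd ?F a q = pd F a q \<bullet> b" if "q \<in> D" for a q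
    by (rule pd_bounded_linear[OF bounded_linear_inner_left]) (use assms that in \<open>auto simp: numeral_2_eq_2\<close>)
  have dd: "pd (pd ?F a) c p = pd (pd F a) c p \<bullet> b" if "a \<in> {1, \<i>}" for a c
  proof -
    have "pd (pd ?F a) c p = pd (\<lambda>q. pd F a q \<bullet> b) c p"
      by (rule pd_cong[OF assms(1,2) d])
    also have "\<dots> = pd (pd F a) c p \<bullet> b"
      by (rule pd_bounded_linear[OF bounded_linear_inner_left]) (use assms that in \<open>auto simp: numeral_2_eq_2\<close>)
    finally show ?thesis .
  qed
  show "pd (pd F 1) \<i> p \<bullet> b = pd (pd F \<i>) 1 p \<bullet> b"
    using pd_commute_real[OF assms(1,2) Ck_on_bounded_linear[OF assms(1) bounded_linear_inner_left[of b] assms(3)]]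
    by (simp add: dd)
qed

section \<open>The bilinear form\<close>

lemma bil_commute: "bil v w = bil w v"
  by (simp add: bil_def algebra_simps)

lemma bil_scale [simp]:
  "bil (c *s v) w = c * bil v w" "bil v (c *s w) = c * bil v w"
  by (simp_all add: bil_def algebra_simps)

lemma bounded_bilinear_bil: "bounded_bilinear bil"
proof -
  have "bilinear bil"
    unfolding bilinear_def bil_def
    by (auto intro!: linearI simp: algebra_simps)
  then show ?thesis by (simp add: bilinear_conv_bounded_bilinear)
qed

interpretation bil: bounded_bilinear bil
  by (rule bounded_bilinear_bil)

lemma bounded_linear_vcnj: "bounded_linear (vcnj :: complex^'n \<Rightarrow> complex^'n)"
  unfolding linear_conv_bounded_linear[symmetric] vcnj_def
  by (auto intro!: linearI simp: vec_eq_iff)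

lemma vcnj_linear [simp]:
  "vcnj (v + w) = vcnj v + vcnj w" "vcnj (v - w) = vcnj v - vcnj w" "vcnj (- v) = - vcnj v"
  "vcnj 0 = 0" "vcnj (r *\<^sub>R v) = r *\<^sub>R vcnj v"
  by (simp_all add: vcnj_def vec_eq_iff)

lemma vcnj_scale [simp]: "vcnj (c *s v) = cnj c *s vcnj v"
  by (simp add: vcnj_def vec_eq_iff)

lemma vcnj_vcnj [simp]: "vcnj (vcnj v) = v"
  by (simp add: vcnj_def vec_eq_iff)

lemma cnj_bil [simp]: "cnj (bil v w) = bil (vcnj v) (vcnj w)"
  by (simp add: bil_def vcnj_def)

lemma bounded_bilinear_vec_scale: "bounded_bilinear (\<lambda>c (v :: complex^'n). c *s v)"
proof -
  have "bilinear (\<lambda>c (v :: complex^'n). c *s v)"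
    unfolding bilinear_def by (auto intro!: linearI simp: vec_eq_iff algebra_simps)
  then show ?thesis by (simp add: bilinear_conv_bounded_bilinear)
qed

text \<open>Duality says that the matrix of the b has a right inverse built from the d, with the
  signature absorbed. For square matrices it is also a left inverse, and this is the resolution of
  the identity.\<close>

lemma bil_dual_basis:
  fixes b d :: "4 \<Rightarrow> complex^4"
  assumes "\<And>i j. bil (b i) (d j) = (if i = j then 1 else 0)"
  shows "bil v w = (\<Sum>j\<in>UNIV. bil v (d j) * bil (b j) w)"
proof -
  define s :: "4 \<Rightarrow> complex" where "s i = (if i = 1 \<or> i = 2 then -1 else 1)" for i
  have bil: "bil x y = (\<Sum>k\<in>UNIV. s k * x$k * y$k)" for x y
    by (simp add: bil_def sum_4 s_def)
  define M :: "complex^4^4" where "M = (\<chi> i k. b i $ k)"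
  define N :: "complex^4^4" where "N = (\<chi> k j. s k * d j $ k)"
  have "M ** N = mat 1"
    using assms unfolding bil by (simp add: M_def N_def matrix_matrix_mult_def mat_def vec_eq_iff algebra_simps)
  then have "N ** M = mat 1" by (simp add: matrix_left_right_inverse)
  then have NM: "(\<Sum>j\<in>UNIV. s k * d j $ k * b j $ l) = (if k = l then 1 else 0)" for k l
    by (simp add: M_def N_def matrix_matrix_mult_def mat_def vec_eq_iff)
  have "(\<Sum>j\<in>UNIV. bil v (d j) * bil (b j) w)
      = (\<Sum>j\<in>UNIV. \<Sum>k\<in>UNIV. \<Sum>l\<in>UNIV. v$k * s l * w$l * (s k * d j $ k * b j $ l))"
    unfolding bil by (simp add: sum_product algebra_simps)
  also have "\<dots> = (\<Sum>k\<in>UNIV. \<Sum>l\<in>UNIV. \<Sum>j\<in>UNIV. v$k * s l * w$l * (s k * d j $ k * b j $ l))"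
    by (subst sum.swap, rule sum.cong[OF refl], rule sum.swap)
  also have "\<dots> = (\<Sum>k\<in>UNIV. \<Sum>l\<in>UNIV. v$k * s l * w$l * (if k = l then 1 else 0))"
    by (simp only: sum_distrib_left[symmetric] NM)
  also have "\<dots> = bil v w"
    unfolding bil by (simp add: if_distrib cong: if_cong) (simp add: algebra_simps)
  finally show ?thesis ..
qed

lemma bil_eqI:
  assumes "\<And>w. bil v w = bil v' w"
  shows "v = v'"
proof -
  have "v $ i = v' $ i" for i
    using assms[of "axis i 1"] exhaust_4[of i] by (auto simp: bil_def axis_def)
  then show ?thesis by (simp add: vec_eq_iff)
qed

section \<open>A null vector, its conjugate and a unitary basis of their complement\<close>

locale adapted_basis =
  fixes h a b :: "complex^4" and E :: complex
  assumes hh: "bil h (vcnj h) = -1" "bil h h = 0"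
    and ah: "bil a h = 0" "bil a (vcnj h) = 0"
    and bh: "bil b h = 0" "bil b (vcnj h) = 0"
    and ab: "bil a (vcnj a) = E" "bil b (vcnj b) = E" "bil a (vcnj b) = 0"
    and E: "E \<noteq> 0"
begin

lemma conj_rules:
  "bil (vcnj h) h = -1" "bil (vcnj h) (vcnj h) = 0"
  "bil h a = 0" "bil (vcnj h) a = 0" "bil h b = 0" "bil (vcnj h) b = 0"
  "bil (vcnj a) h = 0" "bil (vcnj b) h = 0" "bil (vcnj a) (vcnj h) = 0" "bil (vcnj b) (vcnj h) = 0"
  "bil h (vcnj a) = 0" "bil h (vcnj b) = 0" "bil (vcnj h) (vcnj a) = 0" "bil (vcnj h) (vcnj b) = 0"
  "bil (vcnj a) a = E" "bil (vcnj b) b = E" "bil (vcnj b) a = 0" "bil b (vcnj a) = 0" "bil (vcnj a) b = 0"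
proof -
  have conj: "bil v w = 0 \<longleftrightarrow> bil (vcnj v) (vcnj w) = 0" for v w
    by (metis cnj_bil complex_cnj_zero_iff)
  show "bil (vcnj h) h = -1" "bil (vcnj h) (vcnj h) = 0"
    "bil h a = 0" "bil (vcnj h) a = 0" "bil h b = 0" "bil (vcnj h) b = 0"
    "bil (vcnj a) h = 0" "bil (vcnj b) h = 0" "bil (vcnj a) (vcnj h) = 0" "bil (vcnj b) (vcnj h) = 0"
    "bil h (vcnj a) = 0" "bil h (vcnj b) = 0" "bil (vcnj h) (vcnj a) = 0" "bil (vcnj h) (vcnj b) = 0"
    "bil (vcnj a) a = E" "bil (vcnj b) b = E" "bil (vcnj b) a = 0" "bil b (vcnj a) = 0" "bil (vcnj a) b = 0"
    using hh ah bh ab conj[of h h] conj[of a h] conj[of a "vcnj h"] conj[of b h] conj[of b "vcnj h"]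
      conj[of a "vcnj b"] by (simp_all add: bil_commute)
qed

lemmas rules = hh ah bh ab conj_rules

text \<open>The basis h, \<open>vcnj h\<close>, a, b has the \<open>bil\<close>-dual basis
  \<open>- vcnj h\<close>, -h, \<open>vcnj a\<close> / E, \<open>vcnj b\<close> / E: the two null
  vectors are paired with each other, the other two with their own conjugates.\<close>

lemma completeness:
  "bil v w = - bil v (vcnj h) * bil h w - bil v h * bil (vcnj h) w
     + (bil v (vcnj a) * bil a w + bil v (vcnj b) * bil b w) / E"
proof -
  define B where "B i = (if i = 1 then h else if i = 2 then vcnj h else if i = 3 then a else b)" for i :: 4
  define B' where "B' i = (if i = 1 then - vcnj h else if i = 2 then - h
      else if i = 3 then (1/E) *s vcnj a else (1/E) *s vcnj b)" for i :: 4
  have "\<forall>i j. bil (B i) (B' j) = (if i = j then 1 else 0)"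
    unfolding forall_4 B_def B'_def by (simp add: bil.minus_right rules E)
  then have "bil v w = (\<Sum>j\<in>UNIV. bil v (B' j) * bil (B j) w)"
    by (intro bil_dual_basis) blast
  then show ?thesis
    by (simp add: sum_4 B_def B'_def bil.minus_right add_divide_distrib)
qed

lemma expansion:
  assumes "bil v h = 0" "bil v (vcnj h) = 0"
  shows "v = (bil v (vcnj a) / E) *s a + (bil v (vcnj b) / E) *s b"
proof (rule bil_eqI)
  fix w
  show "bil v w = bil ((bil v (vcnj a) / E) *s a + (bil v (vcnj b) / E) *s b) w"
    using completeness[of v w] assms by (simp add: bil.add_left add_divide_distrib)
qed

text \<open>For the symmetric matrix S with entries P, Q, R this is S S^* = E^2:
  \<open>completeness\<close> inserted into the products of a, b with their conjugates, whose values
  are E or 0.\<close>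

lemma gram:
  defines "P \<equiv> bil a a" and "Q \<equiv> bil a b" and "R \<equiv> bil b b"
  shows "P * cnj P + Q * cnj Q = E^2" "Q * cnj Q + R * cnj R = E^2"
    "P * cnj Q + Q * cnj R = 0" "cnj P * Q + cnj Q * R = 0"
proof -
  show 1: "P * cnj P + Q * cnj Q = E^2" "Q * cnj Q + R * cnj R = E^2" "cnj P * Q + cnj Q * R = 0"
    using completeness[of "vcnj a" a] completeness[of "vcnj b" b] completeness[of "vcnj a" b] E
    by (simp_all add: rules P_def Q_def R_def field_simps power2_eq_square bil_commute)
  show "P * cnj Q + Q * cnj R = 0" using arg_cong[OF 1(3), of cnj] by (simp del: cnj_bil)
qed

text \<open>From S S^* = E^2 follows (det S) S^* = E^2 adj(S). The trace of this identity is the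
  claim, since a 2x2 matrix and its adjugate have equal trace.\<close>

lemma gram_det_mult_cnj:
  defines "P \<equiv> bil a a" and "Q \<equiv> bil a b" and "R \<equiv> bil b b"
  shows "(P * R - Q^2) * cnj (P + R) = E^2 * (P + R)"
proof -
  have "(x * z - y^2) * (x' + z') = E^2 * (x + z)"
    if "x * x' + y * y' = E^2" "y * y' + z * z' = E^2" "x * y' + y * z' = 0" "x' * y + y' * z = 0"
    for x y z x' y' z'
  proof -
    have "(x * z - y^2) * (x' + z') = z * (x * x' + y * y') + x * (y * y' + z * z')
        - y * (x' * y + y' * z) - y * (x * y' + y * z')"
      by (simp add: algebra_simps power2_eq_square)
    then show ?thesis by (simp only: that) (simp add: algebra_simps)
  qed
  from this[OF gram[folded P_def Q_def R_def]] show ?thesis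
    by (simp del: cnj_bil)
qed

text \<open>Up to scaling this is the norm of one row of S in the basis h_z, h_zbar. It becomes the
  relation |alpha|^2 + |beta|^2 = e^(2u).\<close>

lemma gram_norm:
  defines "P \<equiv> bil a a" and "Q \<equiv> bil a b" and "R \<equiv> bil b b"
  shows "(P - R - 2 * \<i> * Q) * cnj (P - R - 2 * \<i> * Q) + (P + R) * cnj (P + R) = 4 * E^2"
proof -
  have "(x - z - 2 * \<i> * y) * (x' - z' - 2 * (- \<i>) * y') + (x + z) * (x' + z') = 4 * E^2"
    if "x * x' + y * y' = E^2" "y * y' + z * z' = E^2" "x * y' + y * z' = 0" "x' * y + y' * z = 0"
    for x y z x' y' z'
  proof -
    \<comment> \<open>The vanishing summand with \<open>\<i> * \<i> + 1\<close> makes this a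
      polynomial identity in which the imaginary unit is a free symbol.\<close>
    have "(x - z - 2 * \<i> * y) * (x' - z' - 2 * (- \<i>) * y') + (x + z) * (x' + z')
      = 2 * (x * x' + y * y') + 2 * (y * y' + z * z') + 2 * \<i> * (x * y' + y * z') - 2 * \<i> * (x' * y + y' * z)
        - 2 * (\<i> * \<i> + 1) * (y * y') * 2"
      by (simp only: ring_distribs) (simp add: algebra_simps)
    then show ?thesis using that by simp
  qed
  from this[OF gram[folded P_def Q_def R_def]] show ?thesis
    by (simp del: cnj_bil)
qed

end

section \<open>The phase of \<open>beta\<close> and the Laplacian of the lift\<close>

lemmas pd_bil = pd_bounded_bilinear[OF bounded_bilinear_bil]
lemmas differentiable_bil = differentiable_bounded_bilinear[OF bounded_bilinear_bil]
lemmas pd_vcnj = pd_bounded_linear[OF bounded_linear_vcnj]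
lemmas differentiable_vcnj = differentiable_bounded_linear[OF bounded_linear_vcnj]

text \<open>The relation forces the square of \<open>sgn (F z)\<close> to equal k, so
  \<open>sgn (F z)\<close> takes at most two opposite values. Continuity on a connected set selects
  one of them, and \<open>Arg\<close> depends on it alone.\<close>

lemma connected_constant_arg:
  assumes "connected D" "continuous_on D F" "\<And>z. z \<in> D \<Longrightarrow> F z \<noteq> 0"
    and "\<And>z. z \<in> D \<Longrightarrow> F z = k * cnj (F z)"
  shows "\<exists>c. \<forall>z\<in>D. Arg (F z) = c"
proof -
  have "finite ((\<lambda>z. sgn (F z)) ` D)"
  proof (rule finite_subset)
    show "(\<lambda>z. sgn (F z)) ` D \<subseteq> {csqrt k, - csqrt k}"
    proof
      fix w assume "w \<in> (\<lambda>z. sgn (F z)) ` D"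
      then obtain z where z: "z \<in> D" "w = sgn (F z)" by blast
      define r where "r = complex_of_real (cmod (F z))"
      have r: "r \<noteq> 0" "r^2 = F z * cnj (F z)" "w = F z / r"
        using assms(3)[OF z(1)] complex_norm_square[of "F z"] by (simp_all add: r_def z sgn_eq)
      have "w^2 = F z * (k * cnj (F z)) / r^2"
        using assms(4)[OF z(1)] r(3) by (simp add: power2_eq_square)
      also have "\<dots> = k" using r by (simp add: r(2)[symmetric] mult.left_commute)
      finally have "w^2 = (csqrt k)^2" by simp
      then show "w \<in> {csqrt k, - csqrt k}" by (simp only: power2_eq_iff insert_iff empty_iff simp_thms)
    qed
  qed simp
  moreover have "continuous_on D (\<lambda>z. sgn (F z))"
    using assms(2,3) by (intro continuous_on_sgn) auto
  ultimately obtain s where s: "\<And>z. z \<in> D \<Longrightarrow> sgn (F z) = s"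
    using continuous_finite_range_constant[OF assms(1)] unfolding constant_on_def by blast
  have "Arg (F z) = Arg s" if "z \<in> D" for z
  proof -
    have "s = of_real (inverse (cmod (F z))) * F z"
      using s[OF that] by (simp add: sgn_div_norm scaleR_conv_of_real)
    then show ?thesis using assms(3)[OF that] by (simp del: of_real_inverse)
  qed
  then show ?thesis by blast
qed

text \<open>Here \<open>e\<close> stands for 2 e^u, the Hermitian square of h_x and of h_y, which
  explains the bound \<open>e q / 2\<close> on alpha.\<close>

locale quadric_surface =
  fixes D :: "complex set" and h :: "complex \<Rightarrow> complex^4" and e :: "complex \<Rightarrow> real"
  assumes open_D: "open D" and connected_D: "connected D"
    and smooth: "smooth_on D h"
    and basis: "q \<in> D \<Longrightarrow> adapted_basis (h q) (pd h 1 q) (pd h \<i> q) (of_real (e q))"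
    and e_pos: "q \<in> D \<Longrightarrow> e q > 0"
    and alpha_less: "q \<in> D \<Longrightarrow> cmod (alpha h q) < e q / 2"
begin

abbreviation "hx \<equiv> pd h 1"
abbreviation "hy \<equiv> pd h \<i>"
abbreviation "hxx \<equiv> pd hx 1"
abbreviation "hyx \<equiv> pd hy 1"
abbreviation "hyy \<equiv> pd hy \<i>"

definition lap :: "complex \<Rightarrow> complex^4" where
  "lap p = hxx p + hyy p"

lemma Ck: "Ck_on k D h" "Ck_on k D hx" "Ck_on k D hy"
  using smooth unfolding smooth_on_def by (blast, metis Ck_on.simps(2), metis Ck_on.simps(2))

lemma diff [simp]:
  assumes "q \<in> D"
  shows "h differentiable at q" "hx differentiable at q" "hy differentiable at q"
  using Ck(1)[of "Suc (Suc 0)"] assms by auto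

lemma hxy: "p \<in> D \<Longrightarrow> pd hx \<i> p = hyx p"
  by (rule pd_commute[OF open_D _ Ck(1)])

lemma pd_cong_D:
  "p \<in> D \<Longrightarrow> (\<And>q. q \<in> D \<Longrightarrow> F q = G q) \<Longrightarrow> pd F a p = pd G a p"
  by (rule pd_cong[OF open_D])

lemma pd_e:
  assumes p: "p \<in> D"
  defines "E \<equiv> \<lambda>q. complex_of_real (e q)"
  shows "pd E a p = bil (pd hx a p) (vcnj (hx p)) + cnj (bil (pd hx a p) (vcnj (hx p)))"
    "pd E a p = bil (pd hy a p) (vcnj (hy p)) + cnj (bil (pd hy a p) (vcnj (hy p)))"
    "bil (pd hx a p) (vcnj (hy p)) + cnj (bil (pd hy a p) (vcnj (hx p))) = 0"
    "E differentiable at p"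
proof -
  have "E q = bil (hx q) (vcnj (hx q))" "E q = bil (hy q) (vcnj (hy q))" "bil (hx q) (vcnj (hy q)) = 0" if "q \<in> D" for q
    using adapted_basis.ab[OF basis[OF that]] by (simp_all add: E_def)
  note eq = this
  have "pd E a p = pd (\<lambda>q. bil (hx q) (vcnj (hx q))) a p"
    by (rule pd_cong_D[OF p eq(1)])
  then show "pd E a p = bil (pd hx a p) (vcnj (hx p)) + cnj (bil (pd hx a p) (vcnj (hx p)))"
    using p by (simp add: pd_bil pd_vcnj differentiable_vcnj bil_commute)
  have "pd E a p = pd (\<lambda>q. bil (hy q) (vcnj (hy q))) a p"
    by (rule pd_cong_D[OF p eq(2)])
  then show "pd E a p = bil (pd hy a p) (vcnj (hy p)) + cnj (bil (pd hy a p) (vcnj (hy p)))"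
    using p by (simp add: pd_bil pd_vcnj differentiable_vcnj bil_commute)
  have "pd (\<lambda>q. bil (hx q) (vcnj (hy q))) a p = pd (\<lambda>q. 0) a p"
    by (rule pd_cong_D[OF p eq(3)])
  then show "bil (pd hx a p) (vcnj (hy p)) + cnj (bil (pd hy a p) (vcnj (hx p))) = 0"
    using p by (simp add: pd_bil pd_vcnj differentiable_vcnj bil_commute)
  have "(\<lambda>q. bil (hx q) (vcnj (hx q))) differentiable at p"
    using p by (simp add: differentiable_bil differentiable_vcnj)
  then show "E differentiable at p"
    by (rule differentiable_cong_open[OF open_D p, rotated]) (simp add: eq(1))
qed

text \<open>Orthogonality of h_x and h_y, differentiated along y, exchanges the pairing of h_xy with
  h_y for that of h_yy with h_x; differentiated along x, it does the analogous exchange. Symmetry of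
  second derivatives then brings the Laplacian into the trace of the connection.\<close>

lemma trace_connection:
  assumes p: "p \<in> D"
  shows "bil (hxx p) (vcnj (hx p)) + bil (hyx p) (vcnj (hy p))
      = pd (\<lambda>q. of_real (e q)) 1 p + bil (lap p) (vcnj (hx p))"
    "bil (pd hx \<i> p) (vcnj (hx p)) + bil (hyy p) (vcnj (hy p))
      = pd (\<lambda>q. of_real (e q)) \<i> p + bil (lap p) (vcnj (hy p))"
proof -
  have "bil (hyy p) (vcnj (hx p)) = - cnj (bil (hyx p) (vcnj (hy p)))"
    using arg_cong[OF pd_e(3)[OF p, of \<i>], of cnj] hxy[OF p]
    by (simp add: eq_neg_iff_add_eq_0 add.commute bil_commute)
  then show "bil (hxx p) (vcnj (hx p)) + bil (hyx p) (vcnj (hy p))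
      = pd (\<lambda>q. of_real (e q)) 1 p + bil (lap p) (vcnj (hx p))"
    using pd_e(2)[OF p, of 1] by (simp add: lap_def bil.add_left del: cnj_bil)
  have "bil (hxx p) (vcnj (hy p)) = - cnj (bil (pd hx \<i> p) (vcnj (hx p)))"
    using pd_e(3)[OF p, of 1] hxy[OF p] by (simp add: eq_neg_iff_add_eq_0)
  then show "bil (pd hx \<i> p) (vcnj (hx p)) + bil (hyy p) (vcnj (hy p))
      = pd (\<lambda>q. of_real (e q)) \<i> p + bil (lap p) (vcnj (hy p))"
    using pd_e(1)[OF p, of \<i>] by (simp add: lap_def bil.add_left del: cnj_bil)
qed

text \<open>By conformality the mean curvature has no tangential component.\<close>

lemma Re_bil_lap:
  assumes p: "p \<in> D"
  shows "Re (bil (lap p) (vcnj (hx p))) = 0" "Re (bil (lap p) (vcnj (hy p))) = 0"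
  using arg_cong[OF trace_connection(1)[OF p], of Re] arg_cong[OF pd_e(1)[OF p, of 1], of Re]
    arg_cong[OF pd_e(2)[OF p, of 1], of Re] arg_cong[OF trace_connection(2)[OF p], of Re]
    arg_cong[OF pd_e(1)[OF p, of \<i>], of Re] arg_cong[OF pd_e(2)[OF p, of \<i>], of Re]
  by (simp_all del: cnj_bil)

definition gram_det :: "complex \<Rightarrow> complex" where
  "gram_det q = bil (hx q) (hx q) * bil (hy q) (hy q) - (bil (hx q) (hy q))^2"

lemma beta_eq: "beta h q = (bil (hx q) (hx q) + bil (hy q) (hy q)) / 4"
  unfolding beta_def wirt_z_def wirt_zbar_def
  by (simp add: bil.add_left bil.add_right bil.diff_left bil.diff_right bil_commute field_simps)

lemma alpha_eq: "alpha h q = (bil (hx q) (hx q) - bil (hy q) (hy q) - 2 * \<i> * bil (hx q) (hy q)) / 4"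
  unfolding alpha_def wirt_z_def
  by (simp add: bil.add_left bil.add_right bil.diff_left bil.diff_right bil_commute field_simps)

lemma norm_beta:
  assumes "q \<in> D"
  shows "(cmod (beta h q))^2 = (e q / 2)^2 - (cmod (alpha h q))^2"
proof -
  have "alpha h q * cnj (alpha h q) + beta h q * cnj (beta h q) = (of_real (e q / 2))^2"
  proof -
    have "x / 4 * cnj (x / 4) + y / 4 * cnj (y / 4) = (x * cnj x + y * cnj y) / 16" for x y
      by (simp add: add_divide_distrib)
    then show ?thesis
      unfolding alpha_eq beta_eq by (simp only: adapted_basis.gram_norm[OF basis[OF assms]]) (simp add: power_divide)
  qed
  then have "of_real ((cmod (alpha h q))^2 + (cmod (beta h q))^2) = complex_of_real ((e q / 2)^2)"
    by (simp only: of_real_add complex_norm_square) (simp only: of_real_power)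
  then show ?thesis by (simp only: of_real_eq_iff)
qed

lemma beta_nonzero:
  assumes "q \<in> D"
  shows "beta h q \<noteq> 0"
  using norm_beta[OF assms] power_strict_mono[OF alpha_less[OF assms] norm_ge_zero, of 2] by auto

lemma gram_det_beta:
  assumes "q \<in> D"
  shows "gram_det q * cnj (beta h q) = (of_real (e q))^2 * beta h q"
  using adapted_basis.gram_det_mult_cnj[OF basis[OF assms]]
  by (simp add: beta_eq gram_det_def del: cnj_bil)

text \<open>Jacobi's formula. Up to components in W, which pair to zero with h_x and h_y, the
  derivative of the basis is a matrix A acting on it. So S has derivative A S + S A^T and det S has
  derivative 2 tr(A) det S.\<close>

lemma gram_det_has_derivative:
  assumes p: "p \<in> D"
  defines "E \<equiv> complex_of_real (e p)"
  shows "(gram_det has_derivative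
    (\<lambda>a. 2 * (bil (pd hx a p) (vcnj (hx p)) + bil (pd hy a p) (vcnj (hy p))) * gram_det p / E)) (at p)"
proof -
  let ?P = "bil (hx p) (hx p)" and ?Q = "bil (hx p) (hy p)" and ?R = "bil (hy p) (hy p)"
  interpret adapted_basis "h p" "hx p" "hy p" E using basis[OF p] by (simp add: E_def)
  have bil_der: "((\<lambda>q. bil (F q) (G q)) has_derivative (\<lambda>a. bil (F p) (pd G a p) + bil (pd F a p) (G p))) (at p)"
    if "F differentiable at p" "G differentiable at p" for F G :: "complex \<Rightarrow> complex^4"
    using bounded_bilinear.FDERIV[OF bounded_bilinear_bil has_derivative_pd[OF that(1)] has_derivative_pd[OF that(2)]] .
  have "(gram_det has_derivative (\<lambda>a.
     2 * bil (pd hx a p) (hx p) * ?R + ?P * (2 * bil (pd hy a p) (hy p))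
     - 2 * ?Q * (bil (pd hx a p) (hy p) + bil (pd hy a p) (hx p)))) (at p)"
    unfolding gram_det_def[abs_def]
    by (rule has_derivative_eq_rhs, (rule derivative_intros bil_der diff[OF p])+)
      (simp add: fun_eq_iff algebra_simps bil_commute)
  moreover have "2 * bil (pd hx a p) (hx p) * ?R + ?P * (2 * bil (pd hy a p) (hy p))
     - 2 * ?Q * (bil (pd hx a p) (hy p) + bil (pd hy a p) (hx p))
     = 2 * (bil (pd hx a p) (vcnj (hx p)) + bil (pd hy a p) (vcnj (hy p))) * gram_det p / E" for a
  proof -
    have c: "bil v (hx p) = (bil v (vcnj (hx p)) * ?P + bil v (vcnj (hy p)) * ?Q) / E"
      "bil v (hy p) = (bil v (vcnj (hx p)) * ?Q + bil v (vcnj (hy p)) * ?R) / E" for v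
      using completeness[of v "hx p"] completeness[of v "hy p"] by (simp_all add: rules bil_commute)
    show ?thesis unfolding c[of "pd hx a p"] c[of "pd hy a p"] gram_det_def
      using E by (simp add: field_simps power2_eq_square)
  qed
  ultimately show ?thesis by simp
qed

text \<open>The quotient below is the square of the phase of \<open>beta h\<close>.\<close>

lemma phase_has_derivative:
  assumes p: "p \<in> D"
  defines "E \<equiv> complex_of_real (e p)"
  defines "K \<equiv> \<lambda>q. gram_det q / (of_real (e q))^2"
  shows "(K has_derivative (\<lambda>a. 2 * K p / E *
     (bil (pd hx a p) (vcnj (hx p)) + bil (pd hy a p) (vcnj (hy p)) - pd (\<lambda>q. of_real (e q)) a p))) (at p)"
proof -
  have E: "E \<noteq> 0" using e_pos[OF p] by (simp add: E_def)
  show ?thesis unfolding K_def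
    by (rule has_derivative_eq_rhs, (rule derivative_intros gram_det_has_derivative[OF p] has_derivative_pd pd_e(4)[OF p])+)
      (use E in \<open>simp_all add: E_def[symmetric] fun_eq_iff field_simps power2_eq_square\<close>)
qed

text \<open>\<open>K\<close> is the unimodular quotient of \<open>beta h\<close> and its conjugate.
  By \<open>trace_connection\<close> its logarithmic derivatives are multiples of the pairings with
  \<open>lap\<close>, so these vanish exactly when \<open>K\<close> is constant on the connected set
  \<open>D\<close>.\<close>

lemma lap_eq_zero_iff_constant_arg:
  "(\<forall>p\<in>D. bil (lap p) (vcnj (hx p)) = 0 \<and> bil (lap p) (vcnj (hy p)) = 0)
    \<longleftrightarrow> (\<exists>c. \<forall>z\<in>D. Arg (beta h z) = c)"
proof -
  define K where "K q = gram_det q / (of_real (e q))^2" for q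
  have K: "K q = beta h q / cnj (beta h q)" if "q \<in> D" for q
    using gram_det_beta[OF that] beta_nonzero[OF that] e_pos[OF that] by (simp add: K_def field_simps)
  have K_nz: "K q \<noteq> 0" if "q \<in> D" for q using K beta_nonzero that by simp
  note derK = phase_has_derivative[folded K_def]
  have pdK: "pd K 1 p = 2 * K p / of_real (e p) * bil (lap p) (vcnj (hx p))"
    "pd K \<i> p = 2 * K p / of_real (e p) * bil (lap p) (vcnj (hy p))" if p: "p \<in> D" for p
    using pd_eqI[OF derK[OF p], of 1] pd_eqI[OF derK[OF p], of \<i>] trace_connection[OF p] by simp_all
  have diffK: "K differentiable at p" if "p \<in> D" for p
    using derK[OF that] differentiable_def by blast
  show ?thesis
  proof
    assume 0: "\<forall>p\<in>D. bil (lap p) (vcnj (hx p)) = 0 \<and> bil (lap p) (vcnj (hy p)) = 0"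
    have "pd K v p = 0" if "p \<in> D" for v p
      using pd_directions[OF diffK[OF that], of v] pdK[OF that] 0 that by simp
    then have "\<forall>p\<in>D - {}. (K has_derivative (\<lambda>v. 0)) (at p within D)"
      using has_derivative_pd[OF diffK] has_derivative_at_withinI by fastforce
    moreover have "continuous_on D K"
      using diffK by (auto intro!: continuous_at_imp_continuous_on differentiable_imp_continuous_within)
    ultimately obtain k where k: "\<And>q. q \<in> D \<Longrightarrow> K q = k"
      using has_derivative_zero_connected_constant_on[OF connected_D open_D finite.emptyI]
      unfolding constant_on_def by blast
    show "\<exists>c. \<forall>z\<in>D. Arg (beta h z) = c"
    proof (rule connected_constant_arg[OF connected_D _ beta_nonzero])
      have "continuous_on D (\<lambda>q. beta h q)"
        unfolding beta_eq using bounded_bilinear.continuous_on[OF bounded_bilinear_bil]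
          Ck_on_continuous[OF Ck(2)] Ck_on_continuous[OF Ck(3)]
        by (intro continuous_intros) auto
      then show "continuous_on D (beta h)" by simp
      show "beta h q = k * cnj (beta h q)" if "q \<in> D" for q
        using K[OF that] k[OF that] beta_nonzero[OF that] by (simp add: field_simps)
    qed
  next
    assume "\<exists>c. \<forall>z\<in>D. Arg (beta h z) = c"
    then obtain c where c: "\<And>z. z \<in> D \<Longrightarrow> Arg (beta h z) = c" by blast
    have const: "K q = cis c / cnj (cis c)" if "q \<in> D" for q
    proof -
      have "beta h q = of_real (cmod (beta h q)) * cis c"
        using c[OF that] rcis_cmod_Arg[of "beta h q"] by (simp add: rcis_def)
      then have "K q = of_real (cmod (beta h q)) * cis c / cnj (of_real (cmod (beta h q)) * cis c)"
        using K[OF that] by metis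
      then show ?thesis using beta_nonzero[OF that] by simp
    qed
    have "pd K a p = 0" if "p \<in> D" for a p
      using pd_cong_D[OF that const, of _ a] by simp
    then show "\<forall>p\<in>D. bil (lap p) (vcnj (hx p)) = 0 \<and> bil (lap p) (vcnj (hy p)) = 0"
      using pdK K_nz e_pos by (metis divide_eq_0_iff less_irrefl mult_eq_0_iff of_real_eq_0_iff zero_neq_numeral)
  qed
qed

lemma lap_zero_imp_holomorphic:
  assumes "\<And>p. p \<in> D \<Longrightarrow> bil (lap p) (vcnj (hx p)) = 0" "\<And>p. p \<in> D \<Longrightarrow> bil (lap p) (vcnj (hy p)) = 0"
  shows "alpha h holomorphic_on D"
proof -
  have "alpha h field_differentiable at p" if p: "p \<in> D" for p
  proof -
    interpret adapted_basis "h p" "hx p" "hy p" "of_real (e p)" by (rule basis[OF p])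
    define A where "A a = (2 * bil (pd hx a p) (hx p) - 2 * bil (pd hy a p) (hy p)
        - 2 * \<i> * (bil (pd hx a p) (hy p) + bil (pd hy a p) (hx p))) / 4" for a
    have bil_der: "((\<lambda>q. bil (F q) (G q)) has_derivative (\<lambda>a. bil (F p) (pd G a p) + bil (pd F a p) (G p))) (at p)"
      if "F differentiable at p" "G differentiable at p" for F G :: "complex \<Rightarrow> complex^4"
      using bounded_bilinear.FDERIV[OF bounded_bilinear_bil has_derivative_pd[OF that(1)] has_derivative_pd[OF that(2)]] .
    have der: "(alpha h has_derivative A) (at p)"
      unfolding alpha_eq[abs_def] A_def[abs_def]
      by (rule has_derivative_eq_rhs, (rule derivative_intros bil_der diff[OF p])+)
        (simp_all add: fun_eq_iff field_simps bil_commute)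
    \<comment> \<open>The mixed second derivatives cancel. Up to a factor this says that d alpha / d
      zbar is the \<open>bil\<close> product of \<open>lap\<close> with h_z, and
      \<open>completeness\<close> reduces that product to pairings with conjugates.\<close>
    have "A 1 + \<i> * A \<i> = (bil (lap p) (hx p) - \<i> * bil (lap p) (hy p)) / 2"
      using hxy[OF p] by (simp add: A_def lap_def bil.add_left field_simps)
    also have "\<dots> = 0"
      using completeness[of "lap p" "hx p"] completeness[of "lap p" "hy p"] assms[OF p]
      by (simp add: rules)
    finally have CR: "A \<i> = \<i> * A 1"
      by (metis add.inverse_inverse add_eq_0_iff i_squared minus_mult_right mult.assoc mult.left_neutral mult_minus1)
    have "A v = A 1 * v" for v
    proof -
      have "A v = Re v *\<^sub>R A 1 + Im v *\<^sub>R A \<i>"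
        using pd_directions[of "alpha h" p v] pd_eqI[OF der] der unfolding differentiable_def by metis
      then show ?thesis using CR by (simp add: complex_eq_iff)
    qed
    then have "A = (*) (A 1)" by blast
    then have "(alpha h has_field_derivative A 1) (at p)"
      using der by (simp add: has_field_derivative_def)
    then show ?thesis by (auto simp: field_differentiable_def)
  qed
  then show ?thesis
    by (simp add: holomorphic_on_def field_differentiable_at_within)
qed

end

section \<open>The Fubini-Study connection in the chart\<close>

lemma bounded_linear_homog0: "bounded_linear homog0"
  unfolding linear_conv_bounded_linear[symmetric]
  by (auto intro!: linearI simp: vec_eq_iff homog0_def)

lemma homog0_linear [simp]:
  "homog0 (v + w) = homog0 v + homog0 w" "homog0 (c *s v) = c *s homog0 v"
  "homog0 (r *\<^sub>R v) = r *\<^sub>R homog0 v"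
  by (simp_all add: vec_eq_iff homog0_def)

lemma homog_affine: "homog y = homog 0 + homog0 y"
  by (simp add: vec_eq_iff forall_4)

lemma homog_has_derivative: "(homog has_derivative homog0) (at x)"
proof -
  have "((\<lambda>y. homog 0 + homog0 y) has_derivative (\<lambda>v. 0 + homog0 v)) (at x)"
    by (intro derivative_intros bounded_linear_imp_has_derivative bounded_linear_homog0)
  then show ?thesis by (simp add: homog_affine[symmetric] eta_contract_eq)
qed

lemma scaleR_eq_vec_scale: "r *\<^sub>R v = complex_of_real r *s (v :: complex^'n)"
  by (simp add: vec_eq_iff) (simp add: scaleR_conv_of_real)

lemma homog_dehomog:
  assumes "z$1 \<noteq> 0"
  shows "homog (dehomog z) = (1 / z$1) *s z"
  using assms by (simp add: vec_eq_iff forall_4)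

lemma cnj_herm: "cnj (herm v w) = herm w v"
  by (simp add: herm_def bil_commute)

lemma herm_self: "herm z z = of_real (Re (herm z z))"
  using cnj_herm[of z z] by (simp add: complex_eq_iff)

lemma herm_scale [simp]:
  "herm (c *s v) w = c * herm v w" "herm v (c *s w) = cnj c * herm v w"
  by (simp_all add: herm_def)

lemma herm_add [simp]:
  "herm (v + v') w = herm v w + herm v' w" "herm v (w + w') = herm v w + herm v w'"
  by (simp_all add: herm_def bil.add_left bil.add_right)

lemma bounded_bilinear_herm: "bounded_bilinear herm"
proof -
  have "bounded_linear (\<lambda>w :: complex^4. vcnj w)" by (rule bounded_linear_vcnj)
  then show ?thesis
    unfolding herm_def[abs_def]
    using bounded_bilinear.comp[OF bounded_bilinear_bil bounded_linear_ident] by blast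
qed

lemma hor_vec_scale:
  assumes "cmod c = 1"
  shows "hor_vec (c *s z) v = c *s hor_vec z v"
proof -
  have "c * cnj c = 1" using assms complex_norm_square[of c] by simp
  then show ?thesis
    unfolding hor_vec_def by (simp add: vec_eq_iff algebra_simps)
qed

lemma hor_vec_linear:
  "hor_vec z (v + w) = hor_vec z v + hor_vec z w" "hor_vec z (c *s v) = c *s hor_vec z v"
  "hor_vec z (r *\<^sub>R v) = r *\<^sub>R hor_vec z v"
proof -
  show "hor_vec z (v + w) = hor_vec z v + hor_vec z w"
    unfolding hor_vec_def by (simp add: vec_eq_iff algebra_simps)
  show scale: "hor_vec z (c *s v) = c *s hor_vec z v" for c
    unfolding hor_vec_def by (simp add: vec_eq_iff algebra_simps)
  show "hor_vec z (r *\<^sub>R v) = r *\<^sub>R hor_vec z v"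
    unfolding scaleR_eq_vec_scale by (rule scale)
qed

lemma hor_vec_inj:
  assumes "z$1 \<noteq> 0" "hor_vec z v = hor_vec z w"
  shows "v = w"
  using vector_derivative_unique_at[OF hor_vec_projects[OF assms(1)]]
    hor_vec_projects[OF assms(1), of v] assms(2) hor_vec_projects[OF assms(1), of w] by simp

text \<open>\<open>unit_lift\<close> differs from z by a factor c of modulus one. Since
  \<open>hor_vec\<close> is equivariant under such factors and \<open>herm\<close> is invariant, any
  point of the fibre computes the metric.\<close>

lemma
  assumes "z \<in> H73" "z$1 \<noteq> 0"
  shows herm_homog_dehomog: "herm (homog (dehomog z)) (homog (dehomog z)) = - of_real ((1 / cmod (z$1))^2)"
    and ch_metric_lift: "ch_metric (dehomog z) v w = Re (herm (hor_vec z v) (hor_vec z w))"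
proof -
  have r: "herm (homog (dehomog z)) (homog (dehomog z)) = - (1 / (z$1 * cnj (z$1)))"
    using assms by (simp add: homog_dehomog H73_def)
  then show s: "herm (homog (dehomog z)) (homog (dehomog z)) = - of_real ((1 / cmod (z$1))^2)"
    by (simp only: complex_norm_square[symmetric]) (simp add: power_divide)
  define c where "c = of_real (cmod (z$1)) / z$1"
  have "sqrt ((1 / cmod (z$1))^2) = 1 / cmod (z$1)" by (rule real_sqrt_unique) auto
  then have "unit_lift (dehomog z) = c *s z"
    unfolding unit_lift_def s using assms(2) by (simp add: c_def homog_dehomog vec_eq_iff del: real_sqrt_abs)
  moreover have c: "cmod c = 1" using assms(2) by (simp add: c_def norm_divide)
  moreover have "herm (c *s x) (c *s y) = c * cnj c * herm x y" for x y by simp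
  moreover have "c * cnj c = 1" using c complex_norm_square[of c] by simp
  ultimately show "ch_metric (dehomog z) v w = Re (herm (hor_vec z v) (hor_vec z w))"
    unfolding ch_metric_def by (simp only: hor_vec_scale mult_1)
qed

text \<open>Positive exactly at the chart points of \<open>CH31\<close>. Minus its logarithm is a
  Kaehler potential: its complex Hessian is the expression in
  \<open>ch_metric_formula\<close>.\<close>

definition chart_norm :: "complex^3 \<Rightarrow> real" where
  "chart_norm y = - Re (herm (homog y) (homog y))"

lemma ch_metric_formula:
  assumes "chart_norm y > 0"
  shows "ch_metric y v w = Re (herm (homog0 v) (homog0 w)) / chart_norm y
     + Re (herm (homog0 v) (homog y) * herm (homog y) (homog0 w)) / (chart_norm y)^2"
proof -
  define s where "s = 1 / sqrt (chart_norm y)"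
  define S where "S = complex_of_real s"
  have s2: "s * s = 1 / chart_norm y" using assms by (simp add: s_def)
  have hh: "herm (homog y) (homog y) = - of_real (chart_norm y)"
    using herm_self[of "homog y"] by (simp add: chart_norm_def)
  have S2: "S * S * of_real (chart_norm y) = 1"
    using s2 assms by (simp add: S_def flip: of_real_mult)
  define V where "V = herm (homog0 v) (homog y)"
  define W where "W = herm (homog y) (homog0 w)"
  have cnjW: "herm (homog0 w) (homog y) = cnj W" by (simp add: W_def cnj_herm)
  have lift: "unit_lift y = S *s homog y" "cnj S = S"
    by (simp_all add: unit_lift_def S_def s_def chart_norm_def)
  have "herm (hor_vec (S *s homog y) v) (hor_vec (S *s homog y) w)
     = S * S * (herm (homog0 v) (homog0 w) + 2 * (S * S) * V * W - (S * S) * (S * S * of_real (chart_norm y)) * V * W)"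
    unfolding hor_vec_def by (simp add: lift hh V_def[symmetric] cnjW W_def[symmetric] cnj_herm algebra_simps)
  also have "\<dots> = of_real (1 / chart_norm y) * herm (homog0 v) (homog0 w) + of_real ((1 / chart_norm y)^2) * (V * W)"
    unfolding S2 using s2 by (simp add: S_def algebra_simps power2_eq_square flip: of_real_mult)
  finally show ?thesis
    unfolding ch_metric_def lift V_def W_def by (simp add: power_divide)
qed

text \<open>Supplies the uniqueness that the definite description in \<open>christoffel\<close>
  requires.\<close>

lemma ch_metric_nondegenerate:
  assumes \<rho>: "chart_norm y > 0" and 0: "\<And>k. ch_metric y c k = 0"
  shows "c = 0"
proof -
  \<comment> \<open>This value makes \<open>homog0 c + t *s homog y\<close> Hermitian orthogonal to
    \<open>homog y\<close>; up to scale it is the horizontal lift of c.\<close>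
  define t where "t = herm (homog0 c) (homog y) / of_real (chart_norm y)"
  have hh: "herm (homog y) (homog y) = - of_real (chart_norm y)"
    using herm_self[of "homog y"] by (simp add: chart_norm_def)
  have Re0: "Re (herm (homog0 c + t *s homog y) (homog0 k)) = 0" for k
  proof -
    have "ch_metric y c k = Re (herm (homog0 c + t *s homog y) (homog0 k) / of_real (chart_norm y))"
      unfolding ch_metric_formula[OF \<rho>] t_def using \<rho> by (simp add: power2_eq_square add_divide_distrib)
    then show ?thesis using 0[of k] \<rho> by simp
  qed
  define u where "u = homog0 c + t *s homog y"
  \<comment> \<open>The metric is only a real part; testing against \<open>k\<close> and
    \<open>\<i> *s k\<close> recovers the complex product.\<close>
  have h0: "herm u (homog0 k) = 0" for k
    using Re0[of k] Re0[of "\<i> *s k"] by (simp add: complex_eq_iff u_def)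
  have hy: "herm u (homog y) = 0"
    using \<rho> by (simp add: u_def t_def hh)
  have "vcnj u = 0"
  proof (rule bil_eqI)
    fix w :: "complex^4"
    \<comment> \<open>The vectors \<open>homog0 k\<close> fill the hyperplane of vanishing first
      coordinate. Subtracting \<open>w$1 *s homog y\<close> moves w into it.\<close>
    define k :: "complex^3" where "k = (\<chi> i. if i = 1 then w$2 - w$1 * y$1 else if i = 2 then w$3 - w$1 * y$2 else w$4 - w$1 * y$3)"
    have "w = homog0 k + w$1 *s homog y"
      by (simp add: vec_eq_iff forall_4 k_def)
    then have "herm u w = herm u (homog0 k) + cnj (w$1) * herm u (homog y)"
      by (metis herm_add(2) herm_scale(2))
    then have "herm u w = 0" by (simp add: h0 hy)
    then show "bil (vcnj u) w = bil 0 w"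
      using cnj_bil[of u "vcnj w"] by (simp add: herm_def bil.zero_left)
  qed
  then have u: "u = 0" by (metis vcnj_linear(4) vcnj_vcnj)
  have "t = 0" using arg_cong[OF u, of "\<lambda>x. x$1"] by (simp add: u_def)
  then have "homog0 c = 0" using u by (simp add: u_def)
  then show ?thesis by (simp add: vec_eq_iff forall_3 forall_4)
qed

lemma chart_norm_has_derivative:
  "(chart_norm has_derivative (\<lambda>v. - 2 * Re (herm (homog0 v) (homog x)))) (at x)"
proof -
  note hom = homog_has_derivative[of x]
  have "((\<lambda>y. - Re (herm (homog y) (homog y))) has_derivative
      (\<lambda>v. - Re (herm (homog x) (homog0 v) + herm (homog0 v) (homog x)))) (at x)"
    by (rule derivative_intros bounded_bilinear.FDERIV[OF bounded_bilinear_herm] hom)+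
  moreover have "Re (herm (homog x) w) = Re (herm w (homog x))" for w
    using arg_cong[OF cnj_herm[of w "homog x"], of Re] by simp
  ultimately show ?thesis by (simp add: chart_norm_def[abs_def])
qed

lemma ch_metric_frechet_derivative:
  assumes \<rho>: "chart_norm x > 0"
  defines "a \<equiv> \<lambda>v. herm (homog0 v) (homog x)"
    and "H \<equiv> \<lambda>v w. herm (homog0 v) (homog0 w)"
  shows "frechet_derivative (\<lambda>y. ch_metric y w k) (at x) v =
     2 * Re (a v) * Re (H w k) / (chart_norm x)^2
     + Re (H w v * cnj (a k) + a w * H v k) / (chart_norm x)^2
     + 4 * Re (a v) * Re (a w * cnj (a k)) / (chart_norm x)^3"
proof -
  note hom = homog_has_derivative[of x]
  define N where "N y = Re (herm (homog0 w) (homog y) * herm (homog y) (homog0 k))" for y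
  have "(N has_derivative (\<lambda>v. Re ((herm (homog0 w) (homog x) * (herm (homog x) 0 + herm (homog0 v) (homog0 k))
      + (herm (homog0 w) (homog0 v) + herm 0 (homog x)) * herm (homog x) (homog0 k))))) (at x)"
    unfolding N_def[abs_def]
    by (rule derivative_intros bounded_bilinear.FDERIV[OF bounded_bilinear_herm] hom)+
  then have N: "(N has_derivative (\<lambda>v. Re (H w v * cnj (a k) + a w * H v k))) (at x)"
    by (simp add: a_def H_def cnj_herm bounded_bilinear.zero_left[OF bounded_bilinear_herm]
        bounded_bilinear.zero_right[OF bounded_bilinear_herm] add.commute)
  have Nx: "N x = Re (a w * cnj (a k))" by (simp add: N_def a_def cnj_herm)
  \<comment> \<open>The explicit formula for the metric is valid only where
    \<open>chart_norm\<close> is positive. That set is open, so the derivative of \<open>f\<close>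
    can be transferred to \<open>ch_metric\<close>.\<close>
  define f where "f y = Re (H w k) / chart_norm y + N y / (chart_norm y * chart_norm y)" for y
  have cont: "continuous_on UNIV chart_norm"
    by (intro continuous_at_imp_continuous_on ballI has_derivative_continuous[OF chart_norm_has_derivative])
  then have op: "open {y. chart_norm y > 0}"
    by (intro open_Collect_less continuous_on_const)
  have quotient: "(0 * r - B * (- 2 * A)) / (r * r) + (C' * (r * r) - C * (r * (- 2 * A) + (- 2 * A) * r)) / (r * r * (r * r))
      = 2 * A * B / r^2 + C' / r^2 + 4 * A * C / r^3" if "r > 0" for r A B C C' :: real
  proof -
    have "(0 * r - B * (- 2 * A)) / (r * r) = 2 * A * B / r^2" "C' * (r * r) / (r * r * (r * r)) = C' / r^2"
      "C * (r * (- 2 * A) + (- 2 * A) * r) / (r * r * (r * r)) = - (4 * A * C / r^3)"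
      using that by (simp_all add: power2_eq_square power3_eq_cube ac_simps)
    then show ?thesis by (simp only: diff_divide_distrib[of "C' * (r * r)"])
  qed
  have "(f has_derivative (\<lambda>v. (0 * chart_norm x - Re (H w k) * (- 2 * Re (a v))) / (chart_norm x * chart_norm x)
      + (Re (H w v * cnj (a k) + a w * H v k) * (chart_norm x * chart_norm x)
         - N x * (chart_norm x * (- 2 * Re (a v)) + (- 2 * Re (a v)) * chart_norm x))
        / (chart_norm x * chart_norm x * (chart_norm x * chart_norm x)))) (at x)"
    unfolding f_def[abs_def] a_def
    by (intro derivative_intros chart_norm_has_derivative N[unfolded a_def]) (use \<rho> in auto)
  then have derf: "(f has_derivative (\<lambda>v. 2 * Re (a v) * Re (H w k) / (chart_norm x)^2
     + Re (H w v * cnj (a k) + a w * H v k) / (chart_norm x)^2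
     + 4 * Re (a v) * Re (a w * cnj (a k)) / (chart_norm x)^3)) (at x)"
    unfolding quotient[OF \<rho>] Nx .
  have eq: "f y = ch_metric y w k" if "y \<in> {y. chart_norm y > 0}" for y
    using that by (simp add: f_def N_def H_def ch_metric_formula power2_eq_square)
  have "((\<lambda>y. ch_metric y w k) has_derivative (\<lambda>v. 2 * Re (a v) * Re (H w k) / (chart_norm x)^2
     + Re (H w v * cnj (a k) + a w * H v k) / (chart_norm x)^2
     + 4 * Re (a v) * Re (a w * cnj (a k)) / (chart_norm x)^3)) (at x)"
    by (rule has_derivative_transform_within_open[OF derf op _ eq]) (use \<rho> in auto)
  from frechet_derivative_at[OF this, symmetric] show ?thesis by simp
qed

text \<open>The Koszul formula with all Hermitian products replaced by free scalars:
  \<open>av\<close>, \<open>aw\<close>, \<open>ak\<close> are products with the base point, and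
  \<open>Hvw\<close>, \<open>Hwk\<close>, \<open>Hvk\<close> those among the three vectors.
  Conjugates stand for products in the opposite order.\<close>

lemma koszul_identity:
  fixes av aw ak Hvw Hwk Hvk :: complex and r :: real
  assumes "r > 0"
  shows "2 * (Re (av / of_real r * Hwk + aw / of_real r * Hvk) / r
      + Re ((av / of_real r * aw + aw / of_real r * av) * cnj ak) / r^2)
    = 2 * Re av * Re Hwk / r^2 + Re (cnj Hvw * cnj ak + aw * Hvk) / r^2 + 4 * Re av * Re (aw * cnj ak) / r^3
    + (2 * Re aw * Re Hvk / r^2 + Re (Hvw * cnj ak + av * Hwk) / r^2 + 4 * Re aw * Re (av * cnj ak) / r^3)
    - (2 * Re ak * Re Hvw / r^2 + Re (Hvk * cnj aw + av * cnj Hwk) / r^2 + 4 * Re ak * Re (av * cnj aw) / r^3)"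
  using assms by (simp add: field_simps power2_eq_square power3_eq_cube)

text \<open>Here \<open>a\<close> is minus the (1,0)-differential of the logarithm of
  \<open>chart_norm\<close>. The complex bilinear form of the answer is typical of a Kaehler metric
  in holomorphic coordinates; the Koszul formula confirms it and nondegeneracy excludes other
  solutions.\<close>

lemma christoffel_ch_metric:
  assumes \<rho>: "chart_norm x > 0"
  defines "a \<equiv> \<lambda>v. herm (homog0 v) (homog x) / of_real (chart_norm x)"
  shows "christoffel ch_metric x v w = a v *s w + a w *s v"
  unfolding christoffel_def
proof (rule the_equality)
  let ?c = "a v *s w + a w *s v"
  show koszul: "\<forall>k. 2 * ch_metric x ?c k =
      frechet_derivative (\<lambda>y. ch_metric y w k) (at x) v
      + frechet_derivative (\<lambda>y. ch_metric y v k) (at x) w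
      - frechet_derivative (\<lambda>y. ch_metric y v w) (at x) k"
  proof
    fix k
    show "2 * ch_metric x ?c k =
      frechet_derivative (\<lambda>y. ch_metric y w k) (at x) v
      + frechet_derivative (\<lambda>y. ch_metric y v k) (at x) w
      - frechet_derivative (\<lambda>y. ch_metric y v w) (at x) k"
      using koszul_identity[OF \<rho>, of "herm (homog0 v) (homog x)" "herm (homog0 w) (homog0 k)"
          "herm (homog0 w) (homog x)" "herm (homog0 v) (homog0 k)" "herm (homog0 k) (homog x)"
          "herm (homog0 v) (homog0 w)"]
      unfolding ch_metric_frechet_derivative[OF \<rho>] ch_metric_formula[OF \<rho>] a_def
      by (simp only: cnj_herm herm_add herm_scale homog0_linear)
  qed
  fix c
  assume c: "\<forall>k. 2 * ch_metric x c k =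
      frechet_derivative (\<lambda>y. ch_metric y w k) (at x) v
      + frechet_derivative (\<lambda>y. ch_metric y v k) (at x) w
      - frechet_derivative (\<lambda>y. ch_metric y v w) (at x) k"
  have "ch_metric x (c + (-1) *s ?c) k = ch_metric x c k - ch_metric x ?c k" for k
    unfolding ch_metric_def
    by (simp only: hor_vec_linear(1)[of _ c] hor_vec_linear(2)[of _ "-1"] herm_add herm_scale) simp
  then have "ch_metric x (c + (-1) *s ?c) k = 0" for k using c koszul by (metis diff_self mult_left_cancel zero_neq_numeral)
  from ch_metric_nondegenerate[OF \<rho> this] have "c + (-1) *s ?c = 0" .
  moreover have "c + (-1) *s ?c = c - ?c" by (simp add: vec_eq_iff)
  ultimately show "c = ?c" by simp
qed

section \<open>Derivatives of a horizontal lift\<close>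

lemma
  fixes h :: "complex \<Rightarrow> complex^4" and x :: "complex \<Rightarrow> complex^3"
  assumes D: "open D" and p: "p \<in> D" and C: "Ck_on 2 D h"
    and Cx: "Ck_on 2 D x" and x: "\<And>q. q \<in> D \<Longrightarrow> x q = dehomog (h q)"
    and H73: "\<And>q. q \<in> D \<Longrightarrow> h q \<in> H73" and h1: "\<And>q. q \<in> D \<Longrightarrow> h q $ 1 \<noteq> 0"
    and hor: "\<And>q a. q \<in> D \<Longrightarrow> bil (pd h a q) (vcnj (h q)) = 0"
  shows pd_horizontal_lift: "pd h a p = hor_vec (h p) (pd x a p)"
    and pd_pd_horizontal_lift: "b \<in> {1, \<i>} \<Longrightarrow> \<exists>c. pd (pd h b) a p =
      hor_vec (h p) (pd (pd x b) a p + christoffel ch_metric (x p) (pd x a p) (pd x b p)) + c *s h p"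
proof -
  have dh: "h differentiable at q" "x differentiable at q" if "q \<in> D" for q
    using C Cx that by (auto simp: numeral_2_eq_2)
  have dxb: "pd x b differentiable at q" if "q \<in> D" "b \<in> {1, \<i>}" for q b
    using Cx that by (auto simp: numeral_2_eq_2)
  have hx: "h q = (h q $ 1) *s homog (x q)" if "q \<in> D" for q
    using homog_dehomog[OF h1[OF that]] h1[OF that] x[OF that] by simp
  have homx: "((\<lambda>q. homog (x q)) has_derivative (\<lambda>a. homog0 (pd x a q))) (at q)" if "q \<in> D" for q
    using diff_chain_at[OF has_derivative_pd[OF dh(2)[OF that]] homog_has_derivative] by (simp add: o_def)
  have nth: "((\<lambda>q. h q $ 1) has_derivative (\<lambda>a. pd h a q $ 1)) (at q)" if "q \<in> D" for q
    using bounded_linear.has_derivative[OF bounded_linear_vec_nth has_derivative_pd[OF dh(1)[OF that]]] .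
  have first: "pd h a q = hor_vec (h q) (pd x a q)" if q: "q \<in> D" for q a
  proof -
    have "pd h a q = pd (\<lambda>q. (h q $ 1) *s homog (x q)) a q"
      by (rule pd_cong[OF D q hx])
    also have "\<dots> = (h q $ 1) *s homog0 (pd x a q) + (pd h a q $ 1) *s homog (x q)"
      using pd_eqI[OF bounded_bilinear.FDERIV[OF bounded_bilinear_vec_scale nth[OF q] homx[OF q]]] .
    finally have 1: "pd h a q = (h q $ 1) *s homog0 (pd x a q) + (pd h a q $ 1 / h q $ 1) *s h q"
      using h1[OF q] homog_dehomog[OF h1[OF q]] x[OF q] by simp
    \<comment> \<open>Horizontality determines the logarithmic derivative of the first coordinate,
      and hence the coefficient of h.\<close>
    have "0 = herm ((h q $ 1) *s homog0 (pd x a q) + (pd h a q $ 1 / h q $ 1) *s h q) (h q)"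
      using hor[OF q, of a] 1 by (simp only: herm_def)
    also have "\<dots> = (h q $ 1) * herm (homog0 (pd x a q)) (h q) - pd h a q $ 1 / h q $ 1"
      using H73[OF q] by (simp add: H73_def)
    finally have "pd h a q $ 1 / h q $ 1 = (h q $ 1) * herm (homog0 (pd x a q)) (h q)" by simp
    then show ?thesis using 1 by (simp add: hor_vec_def)
  qed
  then show "pd h a p = hor_vec (h p) (pd x a p)" using p by blast
  assume b: "b \<in> {1, \<i>}"
  let ?m = "\<lambda>v. (h p $ 1) * herm (homog0 v) (h p)"
  \<comment> \<open>On \<open>H73\<close> the value of \<open>chart_norm\<close> is 1 / |h_1|^2,
    which turns the Christoffel coefficient into the one that occurs in
    \<open>hor_vec\<close>.\<close>
  have chr: "christoffel ch_metric (x p) v w = ?m v *s w + ?m w *s v" for v w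
  proof -
    have n: "chart_norm (x p) = (1 / cmod (h p $ 1))^2"
      using herm_homog_dehomog[OF H73[OF p] h1[OF p]] by (simp add: chart_norm_def x[OF p])
    have pos: "chart_norm (x p) > 0" using h1[OF p] by (simp add: n)
    have "herm (homog0 v) (homog (x p)) / of_real (chart_norm (x p)) = ?m v" for v
    proof -
      have "complex_of_real (chart_norm (x p)) = 1 / (h p $ 1 * cnj (h p $ 1))"
        unfolding n by (simp only: complex_norm_square[symmetric]) (simp add: power_divide)
      then show ?thesis using h1[OF p] by (simp add: x[OF p] homog_dehomog)
    qed
    then show ?thesis using christoffel_ch_metric[OF pos] by simp
  qed
  have hom0: "((\<lambda>q. homog0 (pd x b q)) has_derivative (\<lambda>a. homog0 (pd (pd x b) a p))) (at p)"
    using bounded_linear.has_derivative[OF bounded_linear_homog0 has_derivative_pd[OF dxb[OF p b]]] .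
  define m where "m q = (h q $ 1) * herm (homog0 (pd x b q)) (h q)" for q
  have "(m has_derivative (\<lambda>a. (h p $ 1) * (herm (homog0 (pd x b p)) (pd h a p)
      + herm (homog0 (pd (pd x b) a p)) (h p)) + (pd h a p $ 1) * herm (homog0 (pd x b p)) (h p))) (at p)"
    unfolding m_def[abs_def]
    by (intro bounded_bilinear.FDERIV[OF bounded_bilinear_mult] nth[OF p]
        bounded_bilinear.FDERIV[OF bounded_bilinear_herm] hom0 has_derivative_pd dh p)
  then obtain m' where m': "(m has_derivative m') (at p)" by blast
  have "pd (pd h b) a p = pd (\<lambda>q. (h q $ 1) *s homog0 (pd x b q) + m q *s h q) a p"
    by (rule pd_cong[OF D p]) (simp add: first hor_vec_def m_def)
  also have "\<dots> = (h p $ 1) *s homog0 (pd (pd x b) a p) + (pd h a p $ 1) *s homog0 (pd x b p)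
      + (m p *s pd h a p + m' a *s h p)"
    by (rule pd_eqI[OF has_derivative_add[OF bounded_bilinear.FDERIV[OF bounded_bilinear_vec_scale nth[OF p] hom0]
          bounded_bilinear.FDERIV[OF bounded_bilinear_vec_scale m' has_derivative_pd[OF dh(1)[OF p]]]]])
  \<comment> \<open>Of the two first-order products, one contributes
    \<open>?m (pd x a p) *s pd x b p\<close> and the other the same with a and b exchanged; together
    they are the Christoffel term. Everything along \<open>h p\<close> is collected at the
    end.\<close>
  also have "\<dots> = hor_vec (h p) (pd (pd x b) a p + christoffel ch_metric (x p) (pd x a p) (pd x b p))
     + (m' a + m p * ?m (pd x a p)
        - ?m (pd (pd x b) a p + christoffel ch_metric (x p) (pd x a p) (pd x b p))) *s h p"
    unfolding first[OF p] chr hor_vec_def m_def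
    by (simp add: vec_eq_iff algebra_simps)
  finally show "\<exists>c. pd (pd h b) a p =
      hor_vec (h p) (pd (pd x b) a p + christoffel ch_metric (x p) (pd x a p) (pd x b p)) + c *s h p" by blast
qed

section \<open>Second fundamental form and mean curvature in terms of the lift\<close>

locale lagrangian_lift =
  fixes D :: "complex set" and f :: "complex \<Rightarrow> (complex^4) set" and h :: "complex \<Rightarrow> complex^4"
    and u :: "complex \<Rightarrow> real"
  assumes D: "open D" "connected D"
    and quadric: "f ` D \<subseteq> null_quadric"
    and immersion: "immersion_on D f"
    and conformal: "conformal_with D f u"
    and lagrangian: "lagrangian_on D f"
    and lift: "horizontal_lift D f h"
    and alpha_bound: "\<And>z. z \<in> D \<Longrightarrow> (cmod (alpha h z))\<^sup>2 < exp (2 * u z)"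
begin

lemma lift_H73: "q \<in> D \<Longrightarrow> h q \<in> H73" and lift_proj: "q \<in> D \<Longrightarrow> proj_class (h q) = f q"
  using lift unfolding horizontal_lift_def by auto

lemma herm_lift: "q \<in> D \<Longrightarrow> bil (h q) (vcnj (h q)) = -1"
  using lift_H73 by (auto simp: H73_def herm_def)

lemma lift_null:
  assumes "q \<in> D"
  shows "bil (h q) (h q) = 0"
proof -
  obtain z where z: "f q = proj_class z" "bil z z = 0"
    using quadric assms unfolding null_quadric_def by blast
  have "1 *s h q \<in> proj_class (h q)" unfolding proj_class_def by (metis (mono_tags, lifting) mem_Collect_eq one_neq_zero)
  then obtain c where "h q = c *s z"
    using z(1) lift_proj[OF assms] unfolding proj_class_def by auto
  then show ?thesis using z(2) by simp
qed

lemma lift_nth1: "q \<in> D \<Longrightarrow> h q $ 1 \<noteq> 0"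
  using null_quadric_in_chart[of "h q"] lift_null[of q] lift_H73[of q] by (simp add: H73_def)

lemma chart_lift: "q \<in> D \<Longrightarrow> (chart \<circ> f) q = dehomog (h q)"
  using chart_proj_class[OF lift_nth1] lift_proj by simp

lemma Ck_h: "Ck_on k D h" and Ck_chart: "Ck_on k D (chart \<circ> f)"
  using lift immersion unfolding horizontal_lift_def immersion_on_def smooth_on_def by auto

lemma h_differentiable: "q \<in> D \<Longrightarrow> h differentiable at q"
  using Ck_h[of "Suc 0"] by auto

lemma pd_h_horizontal:
  assumes "q \<in> D"
  shows "bil (pd h a q) (vcnj (h q)) = 0"
proof -
  have "bil (wirt_z h q) (vcnj (h q)) = 0" "bil (wirt_zbar h q) (vcnj (h q)) = 0"
    using lift assms unfolding horizontal_lift_def by auto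
  then have "bil (pd h 1 q) (vcnj (h q)) = 0" "bil (pd h \<i> q) (vcnj (h q)) = 0"
    unfolding wirt_z_def wirt_zbar_def by (simp_all add: bil.add_left bil.diff_left)
  then show ?thesis
    using pd_directions[OF h_differentiable[OF assms], of a] by (simp add: bil.add_left bil.scaleR_left)
qed

lemma pd_h_null:
  assumes "q \<in> D"
  shows "bil (pd h a q) (h q) = 0"
proof -
  have "pd (\<lambda>q. bil (h q) (h q)) a q = pd (\<lambda>q. 0) a q"
    by (rule pd_cong[OF D(1) assms lift_null])
  then show ?thesis
    using h_differentiable[OF assms] by (simp add: pd_bil bil_commute)
qed

lemma pd_h: "q \<in> D \<Longrightarrow> pd h a q = hor_vec (h q) (tangent_map f q a)"
  unfolding tangent_map_def
  using pd_horizontal_lift[OF D(1) _ Ck_h Ck_chart chart_lift lift_H73 lift_nth1 pd_h_horizontal] .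

lemma pd_pd_h:
  "q \<in> D \<Longrightarrow> b \<in> {1, \<i>} \<Longrightarrow> \<exists>c. pd (pd h b) a q = hor_vec (h q) (cov_deriv f q a b) + c *s h q"
  unfolding cov_deriv_def tangent_map_def
  using pd_pd_horizontal_lift[where x = "chart \<circ> f", OF D(1) _ Ck_h Ck_chart chart_lift lift_H73 lift_nth1 pd_h_horizontal]
  by (simp only: o_apply)

lemma metric_lift:
  assumes "q \<in> D"
  shows "ch_metric (chart (f q)) v w = Re (bil (hor_vec (h q) v) (vcnj (hor_vec (h q) w)))"
  using ch_metric_lift[OF lift_H73[OF assms] lift_nth1[OF assms]] chart_lift[OF assms]
  by (simp add: herm_def)

text \<open>Conformality gives the real part. The Kaehler form inserts i before the real part is
  taken, so the Lagrangian condition gives the imaginary part.\<close>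

lemma pd_h_conformal:
  assumes "q \<in> D"
  shows "bil (pd h a q) (vcnj (pd h b q)) = of_real (2 * exp (u q) * (a \<bullet> b))"
proof -
  have "Re (bil (pd h a q) (vcnj (pd h b q))) = 2 * exp (u q) * (a \<bullet> b)"
    using conformal assms unfolding conformal_with_def first_ff_def
    by (simp add: metric_lift[OF assms, symmetric] pd_h[OF assms])
  moreover have "Im (bil (pd h a q) (vcnj (pd h b q))) = 0"
  proof -
    have "ch_metric (chart (f q)) (\<i> *s tangent_map f q a) (tangent_map f q b) = 0"
      using lagrangian assms unfolding lagrangian_on_def kaehler_form_def by blast
    then show ?thesis
      unfolding metric_lift[OF assms] by (simp add: pd_h[OF assms] hor_vec_linear)
  qed
  ultimately show ?thesis by (simp add: complex_eq_iff)
qed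

sublocale quadric_surface D h "\<lambda>q. 2 * exp (u q)"
proof (rule quadric_surface.intro, goal_cases)
  case 1
  show ?case by (rule D)
next
  case 2
  show ?case by (rule D)
next
  case 3
  show ?case using lift unfolding horizontal_lift_def by simp
next
  case q: (4 q)
  then show ?case
    by (intro adapted_basis.intro)
      (use q in \<open>simp_all add: herm_lift lift_null pd_h_null pd_h_horizontal pd_h_conformal\<close>)
next
  case (5 q)
  show ?case by simp
next
  case (6 q)
  have "(cmod (alpha h q))^2 < (exp (u q))^2"
    using alpha_bound[OF 6] by (simp add: exp_double)
  then have "cmod (alpha h q) < exp (u q)"
    by (rule power_less_imp_less_base) simp
  then show ?case by simp
qed

text \<open>\<open>hor_vec\<close> differs from a multiple of \<open>homog0 v\<close> by a multiple
  of the null vector \<open>h q\<close>, so its product with \<open>h q\<close> is, up to a nonzero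
  factor, the differential of the quadric's equation.\<close>

lemma quadric_tangent_iff:
  assumes q: "q \<in> D"
  shows "v \<in> quadric_tangent (chart (f q)) \<longleftrightarrow> bil (hor_vec (h q) v) (h q) = 0"
proof -
  let ?x = "chart (f q)"
  have "((\<lambda>y. bil (homog y) (homog y)) has_derivative (\<lambda>v. bil (homog ?x) (homog0 v) + bil (homog0 v) (homog ?x))) (at ?x)"
    by (rule bounded_bilinear.FDERIV[OF bounded_bilinear_bil homog_has_derivative homog_has_derivative])
  from frechet_derivative_at[OF this, symmetric]
  have "v \<in> quadric_tangent ?x \<longleftrightarrow> bil (homog0 v) (homog ?x) = 0"
    by (simp add: quadric_tangent_def bil_commute)
  moreover have "homog ?x = (1 / (h q $ 1)) *s h q"
    using chart_lift[OF q] homog_dehomog[OF lift_nth1[OF q]] by simp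
  ultimately show ?thesis
    using lift_nth1[OF q] by (simp add: hor_vec_def bil.add_left lift_null[OF q])
qed

abbreviation "fx p \<equiv> tangent_map f p 1"
abbreviation "fy p \<equiv> tangent_map f p \<i>"

text \<open>Lifted tangent vectors of the quadric are complex combinations of the orthogonal vectors
  h_x and h_y. Normality to the surface forces both coefficients to be imaginary.\<close>

lemma normal_space_iff:
  assumes q: "q \<in> D"
  shows "n \<in> normal_space f q \<longleftrightarrow> (\<exists>s t. n = \<i> *s (s *\<^sub>R fx q + t *\<^sub>R fy q))"
proof
  interpret adapted_basis "h q" "hx q" "hy q" "of_real (2 * exp (u q))" by (rule basis[OF q])
  let ?L = "hor_vec (h q)"
  have L: "?L (fx q) = hx q" "?L (fy q) = hy q" using pd_h[OF q] by simp_all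
  { assume n: "n \<in> normal_space f q"
    define s where "s = Im (bil (?L n) (vcnj (hx q))) / (2 * exp (u q))"
    define t where "t = Im (bil (?L n) (vcnj (hy q))) / (2 * exp (u q))"
    have "Re (bil (?L n) (vcnj (hx q))) = 0" "Re (bil (?L n) (vcnj (hy q))) = 0"
      using n metric_lift[OF q] L unfolding normal_space_def by (metis (mono_tags, lifting) mem_Collect_eq)+
    then have c: "bil (?L n) (vcnj (hx q)) / of_real (2 * exp (u q)) = \<i> * of_real s"
      "bil (?L n) (vcnj (hy q)) / of_real (2 * exp (u q)) = \<i> * of_real t"
      by (auto simp: s_def t_def complex_eq_iff Re_divide Im_divide power2_eq_square)
    have "bil (?L n) (h q) = 0" using n quadric_tangent_iff[OF q] by (simp add: normal_space_def)
    moreover have "bil (?L n) (vcnj (h q)) = 0"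
      using hor_vec_horizontal[OF lift_H73[OF q]] by (simp add: herm_def)
    ultimately have "?L n = (\<i> * of_real s) *s hx q + (\<i> * of_real t) *s hy q"
      using expansion unfolding c[symmetric] by blast
    also have "\<dots> = ?L (\<i> *s (s *\<^sub>R fx q + t *\<^sub>R fy q))"
      unfolding hor_vec_linear L by (simp add: vec_eq_iff scaleR_conv_of_real[where 'a = complex] algebra_simps)
    finally show "\<exists>s t. n = \<i> *s (s *\<^sub>R fx q + t *\<^sub>R fy q)"
      using hor_vec_inj[OF lift_nth1[OF q]] by blast }
  assume "\<exists>s t. n = \<i> *s (s *\<^sub>R fx q + t *\<^sub>R fy q)"
  then obtain s t where n: "n = \<i> *s (s *\<^sub>R fx q + t *\<^sub>R fy q)" by blast
  then have Ln: "?L n = \<i> *s (s *\<^sub>R hx q + t *\<^sub>R hy q)" by (simp add: hor_vec_linear L)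
  have "bil (?L n) (h q) = 0"
    unfolding Ln by (simp add: bil.add_left bil.scaleR_left rules)
  moreover have "Re (bil (?L n) (vcnj (pd h a q))) = 0" for a
  proof -
    have "bil (hx q) (vcnj (pd h a q)) \<in> \<real>" "bil (hy q) (vcnj (pd h a q)) \<in> \<real>"
      unfolding pd_h_conformal[OF q] by simp_all
    then show ?thesis
      unfolding Ln by (simp add: bil.add_left bil.scaleR_left complex_is_Real_iff)
  qed
  ultimately show "n \<in> normal_space f q"
    using quadric_tangent_iff[OF q] pd_h[OF q] by (simp add: normal_space_def metric_lift[OF q])
qed

text \<open>Conjugating the second argument turns i into -i, and Re(-i z) = Im z.\<close>

lemma metric_normal:
  assumes q: "q \<in> D"
  shows "ch_metric (chart (f q)) w (\<i> *s (s *\<^sub>R fx q + t *\<^sub>R fy q))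
    = s * Im (bil (hor_vec (h q) w) (vcnj (hx q))) + t * Im (bil (hor_vec (h q) w) (vcnj (hy q)))"
  unfolding metric_lift[OF q] hor_vec_linear pd_h[OF q] vcnj_scale vcnj_linear
  by (simp only: bil.add_right bil.scaleR_right bil_scale) simp

text \<open>The vectors i f_x and i f_y are an orthogonal basis of the normal space with squares 2
  e^u, so testing against these two determines the projection.\<close>

lemma normal_part_eq:
  assumes q: "q \<in> D"
  shows "normal_part f q w = (1 / (2 * exp (u q))) *\<^sub>R (\<i> *s
    (Im (bil (hor_vec (h q) w) (vcnj (hx q))) *\<^sub>R fx q + Im (bil (hor_vec (h q) w) (vcnj (hy q))) *\<^sub>R fy q))"
proof -
  interpret adapted_basis "h q" "hx q" "hy q" "of_real (2 * exp (u q))" by (rule basis[OF q])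
  define s where "s = Im (bil (hor_vec (h q) w) (vcnj (hx q))) / (2 * exp (u q))"
  define t where "t = Im (bil (hor_vec (h q) w) (vcnj (hy q))) / (2 * exp (u q))"
  let ?n = "\<lambda>s t. \<i> *s (s *\<^sub>R fx q + t *\<^sub>R fy q)"
  have nn: "ch_metric (chart (f q)) (?n a b) (?n a' b') = 2 * exp (u q) * (a * a' + b * b')" for a b a' b'
    unfolding metric_normal[OF q] unfolding hor_vec_linear pd_h[OF q, symmetric]
    by (simp add: bil.add_left bil.scaleR_left rules algebra_simps)
  have wn: "ch_metric (chart (f q)) w (?n a b) = 2 * exp (u q) * (a * s + b * t)" for a b
    unfolding metric_normal[OF q] by (simp add: s_def t_def field_simps)
  have "normal_part f q w = ?n s t"
    unfolding normal_part_def
  proof (rule the_equality)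
    show "?n s t \<in> normal_space f q \<and>
      (\<forall>m\<in>normal_space f q. ch_metric (chart (f q)) (?n s t) m = ch_metric (chart (f q)) w m)"
    proof (intro conjI ballI)
      show "?n s t \<in> normal_space f q" unfolding normal_space_iff[OF q] by blast
      fix m assume "m \<in> normal_space f q"
      then obtain a b where m: "m = ?n a b" unfolding normal_space_iff[OF q] by blast
      show "ch_metric (chart (f q)) (?n s t) m = ch_metric (chart (f q)) w m"
        unfolding m nn wn by (simp add: mult.commute)
    qed
    fix n
    assume n: "n \<in> normal_space f q \<and>
      (\<forall>m\<in>normal_space f q. ch_metric (chart (f q)) n m = ch_metric (chart (f q)) w m)"
    then obtain a b where ab: "n = ?n a b" unfolding normal_space_iff[OF q] by blast
    have "?n 1 0 \<in> normal_space f q" "?n 0 1 \<in> normal_space f q"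
      unfolding normal_space_iff[OF q] by blast+
    then have "ch_metric (chart (f q)) n (?n 1 0) = ch_metric (chart (f q)) w (?n 1 0)"
      "ch_metric (chart (f q)) n (?n 0 1) = ch_metric (chart (f q)) w (?n 0 1)" using n by blast+
    then show "n = ?n s t" unfolding ab nn wn by simp
  qed
  also have "\<dots> = (1 / (2 * exp (u q))) *\<^sub>R (\<i> *s
    (Im (bil (hor_vec (h q) w) (vcnj (hx q))) *\<^sub>R fx q + Im (bil (hor_vec (h q) w) (vcnj (hy q))) *\<^sub>R fy q))"
    by (simp add: s_def t_def vec_eq_iff algebra_simps)
  finally show ?thesis .
qed

text \<open>In conformal coordinates the trace is a multiple of the sum of the two diagonal terms.
  It sees the imaginary parts of the pairings with \<open>lap\<close>; the real parts vanish already
  by \<open>Re_bil_lap\<close>.\<close>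

lemma mean_curvature_zero_iff:
  assumes q: "q \<in> D"
  shows "mean_curvature f q = 0 \<longleftrightarrow> bil (lap q) (vcnj (hx q)) = 0 \<and> bil (lap q) (vcnj (hy q)) = 0"
proof -
  interpret adapted_basis "h q" "hx q" "hy q" "of_real (2 * exp (u q))" by (rule basis[OF q])
  let ?e = "2 * exp (u q)" and ?L = "hor_vec (h q)"
  let ?n = "\<lambda>s t. \<i> *s (s *\<^sub>R fx q + t *\<^sub>R fy q)"
  have e: "?e > 0" by simp
  have ff: "first_ff f q 1 1 = ?e" "first_ff f q 1 \<i> = 0" "first_ff f q \<i> \<i> = ?e"
    using conformal q unfolding conformal_with_def by (simp_all add: inner_complex_def)
  have cov: "bil (pd (pd h b) a q) (vcnj (hx q)) = bil (?L (cov_deriv f q a b)) (vcnj (hx q))"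
    "bil (pd (pd h b) a q) (vcnj (hy q)) = bil (?L (cov_deriv f q a b)) (vcnj (hy q))"
    if "b \<in> {1, \<i>}" for a b
    using pd_pd_h[OF q that, of a] by (auto simp: bil.add_left rules)
  have "second_ff f q 1 1 + second_ff f q \<i> \<i>
     = (1 / ?e) *\<^sub>R ?n (Im (bil (lap q) (vcnj (hx q)))) (Im (bil (lap q) (vcnj (hy q))))"
    unfolding second_ff_def normal_part_eq[OF q] lap_def bil.add_left
    using cov[of 1 1] cov[of \<i> \<i>] by (simp add: vec_eq_iff algebra_simps)
  then have mc: "mean_curvature f q = (1 / (2 * (?e * ?e - 0^2))) *\<^sub>R ?e *\<^sub>R (1 / ?e) *\<^sub>R
      ?n (Im (bil (lap q) (vcnj (hx q)))) (Im (bil (lap q) (vcnj (hy q))))"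
    unfolding mean_curvature_def Let_def ff by (simp add: scaleR_add_right[symmetric])
  have "?n s t = 0 \<longleftrightarrow> s = 0 \<and> t = 0" for s t
  proof
    assume 0: "?n s t = 0"
    \<comment> \<open>Zero is written as \<open>0 *s fx q\<close> so that linearity of
      \<open>hor_vec\<close> applies to both sides.\<close>
    have "?L (?n s t) = ?L (0 *s fx q)" unfolding 0 by simp
    then have "\<i> *s (s *\<^sub>R hx q + t *\<^sub>R hy q) = 0"
      unfolding hor_vec_linear pd_h[OF q, symmetric] by simp
    then have v: "s *\<^sub>R hx q + t *\<^sub>R hy q = 0" by (simp only: vec.scale_eq_0_iff) simp
    show "s = 0 \<and> t = 0"
      using arg_cong[OF v, of "\<lambda>v. bil v (vcnj (hx q))"] arg_cong[OF v, of "\<lambda>v. bil v (vcnj (hy q))"]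
      by (simp add: bil.add_left bil.scaleR_left rules bil.zero_left)
  qed simp
  then show ?thesis
    unfolding mc using Re_bil_lap[OF q] by (simp add: complex_eq_iff)
qed

lemma minimal_iff_lap:
  "minimal_on D f \<longleftrightarrow> (\<forall>p\<in>D. bil (lap p) (vcnj (hx p)) = 0 \<and> bil (lap p) (vcnj (hy p)) = 0)"
  unfolding minimal_on_def using mean_curvature_zero_iff by blast

end

section \<open>Matrix-valued forms\<close>

lemma bounded_bilinear_matrix_mult: "bounded_bilinear ((**) :: complex^'n^'n \<Rightarrow> complex^'n^'n \<Rightarrow> complex^'n^'n)"
proof -
  have "bilinear ((**) :: complex^'n^'n \<Rightarrow> complex^'n^'n \<Rightarrow> complex^'n^'n)"
    unfolding bilinear_def matrix_matrix_mult_def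
    by (auto intro!: linearI simp: vec_eq_iff algebra_simps sum.distrib scaleR_right.sum)
  then show ?thesis by (simp add: bilinear_conv_bounded_bilinear)
qed

interpretation mm: bounded_bilinear "(**) :: complex^'n^'n \<Rightarrow> complex^'n^'n \<Rightarrow> complex^'n^'n"
  by (rule bounded_bilinear_matrix_mult)

lemma msc_nth [simp]: "msc c A $ i $ j = c * A $ i $ j"
  by (simp add: msc_def map_matrix_def)

lemma msc_mult: "msc c A ** B = msc c (A ** B)" "A ** msc c B = msc c (A ** B)"
  by (simp_all add: vec_eq_iff matrix_matrix_mult_def sum_distrib_left algebra_simps)

lemma bounded_linear_msc: "bounded_linear (msc c)"
  unfolding linear_conv_bounded_linear[symmetric]
  by (auto intro!: linearI simp: vec_eq_iff algebra_simps)

lemma bounded_linear_k_part: "bounded_linear k_part"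
  unfolding linear_conv_bounded_linear[symmetric]
  by (auto intro!: linearI simp: vec_eq_iff k_part_def)

lemma bounded_linear_p_part: "bounded_linear p_part"
  unfolding linear_conv_bounded_linear[symmetric]
  by (auto intro!: linearI simp: vec_eq_iff p_part_def)

lemmas part_simps =
  linear_simps[OF bounded_linear_msc] linear_simps[OF bounded_linear_k_part] linear_simps[OF bounded_linear_p_part]

text \<open>Block-diagonal and block-off-diagonal matrices form a Z/2-grading of the matrix algebra;
  it yields the relations [k,k], [p,p] in k and [k,p] in p.\<close>

lemma k_part_mult: "k_part (A ** B) = k_part A ** k_part B + p_part A ** p_part B"
  and p_part_mult: "p_part (A ** B) = k_part A ** p_part B + p_part A ** k_part B"
  by (simp_all add: vec_eq_iff forall_4 k_part_def p_part_def matrix_matrix_mult_def sum_4)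

text \<open>A two-form on the plane is determined by its value on (1, i): on other pairs it is
  multiplied by their determinant. The factor 1/2 cancels the double count in
  \<open>bracket_wedge\<close>.\<close>

lemma flat_connection_iff:
  fixes \<theta> :: mform
  assumes D: "open D"
    and \<theta>: "\<And>q v. q \<in> D \<Longrightarrow> \<theta> q v = Re v *\<^sub>R A q + Im v *\<^sub>R B q"
    and diff: "\<And>q. q \<in> D \<Longrightarrow> A differentiable at q" "\<And>q. q \<in> D \<Longrightarrow> B differentiable at q"
  shows "flat_connection_on D \<theta> \<longleftrightarrow>
    (\<forall>p\<in>D. pd B 1 p - pd A \<i> p + (A p ** B p - B p ** A p) = 0)"
proof -
  have "ext_d \<theta> p v w + msc (1/2) (bracket_wedge \<theta> \<theta> p v w) =
      (Re v * Im w - Im v * Re w) *\<^sub>R (pd B 1 p - pd A \<i> p + (A p ** B p - B p ** A p))"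
    if p: "p \<in> D" for p v w
  proof -
    have pd: "pd (\<lambda>q. \<theta> q b) a p = Re b *\<^sub>R (Re a *\<^sub>R pd A 1 p + Im a *\<^sub>R pd A \<i> p)
        + Im b *\<^sub>R (Re a *\<^sub>R pd B 1 p + Im a *\<^sub>R pd B \<i> p)" for a b
    proof -
      have "pd (\<lambda>q. \<theta> q b) a p = pd (\<lambda>q. Re b *\<^sub>R A q + Im b *\<^sub>R B q) a p"
        by (rule pd_cong[OF D p \<theta>])
      also have "\<dots> = Re b *\<^sub>R pd A a p + Im b *\<^sub>R pd B a p"
        by (rule pd_eqI) (intro derivative_intros has_derivative_pd diff p)
      finally show ?thesis
        unfolding pd_directions[OF diff(1)[OF p], of a] pd_directions[OF diff(2)[OF p], of a] .
    qed
    have "bracket_wedge \<theta> \<theta> p v w = (2 * (Re v * Im w - Im v * Re w)) *\<^sub>R (A p ** B p - B p ** A p)"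
      unfolding bracket_wedge_def lie_bracket_def \<theta>[OF p]
      by (simp add: mm.add_left mm.add_right mm.scaleR_left mm.scaleR_right vec_eq_iff)
        (simp add: scaleR_conv_of_real algebra_simps)
    moreover have "msc (1/2) ((2 * r) *\<^sub>R X) = r *\<^sub>R X" for r X
      by (simp add: vec_eq_iff scaleR_conv_of_real)
    ultimately have "msc (1/2) (bracket_wedge \<theta> \<theta> p v w)
        = (Re v * Im w - Im v * Re w) *\<^sub>R (A p ** B p - B p ** A p)" by (simp only:)
    then show ?thesis unfolding ext_d_def pd by (simp add: algebra_simps)
  qed
  note eq = this
  show ?thesis
  proof
    assume "flat_connection_on D \<theta>"
    then have "ext_d \<theta> p 1 \<i> + msc (1/2) (bracket_wedge \<theta> \<theta> p 1 \<i>) = 0" if "p \<in> D" for p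
      using that unfolding flat_connection_on_def by blast
    then show "\<forall>p\<in>D. pd B 1 p - pd A \<i> p + (A p ** B p - B p ** A p) = 0"
      using eq[of _ 1 \<i>] by simp
  next
    assume "\<forall>p\<in>D. pd B 1 p - pd A \<i> p + (A p ** B p - B p ** A p) = 0"
    then show "flat_connection_on D \<theta>"
      unfolding flat_connection_on_def using eq by simp
  qed
qed

text \<open>The second derivatives of \<open>F\<close> cancel by symmetry. The derivative of
  \<open>G\<close>, obtained from \<open>G q ** F q = mat 1\<close>, produces the
  commutator.\<close>

lemma maurer_cartan_equation:
  fixes F G :: "complex \<Rightarrow> complex^4^4"
  assumes D: "open D" and p: "p \<in> D" and F: "Ck_on 2 D F" and G: "Ck_on 2 D G"
    and inv: "\<And>q. q \<in> D \<Longrightarrow> G q ** F q = mat 1"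
  defines "P \<equiv> \<lambda>q. G q ** pd F 1 q" and "R \<equiv> \<lambda>q. G q ** pd F \<i> q"
  shows "pd R 1 p - pd P \<i> p + (P p ** R p - R p ** P p) = 0"
proof -
  have d: "F differentiable at p" "G differentiable at p" "pd F 1 differentiable at p" "pd F \<i> differentiable at p"
    using F G p by (auto simp: numeral_2_eq_2)
  have dG: "pd G a p = - (G p ** pd F a p ** G p)" for a
  proof -
    have "pd (\<lambda>q. G q ** F q) a p = pd (\<lambda>q. mat 1) a p"
      by (rule pd_cong[OF D p inv])
    then have "pd G a p ** F p = - (G p ** pd F a p)"
      using pd_bounded_bilinear[OF bounded_bilinear_matrix_mult d(2,1), of a] by (simp add: eq_neg_iff_add_eq_0)
    then have "pd G a p ** F p ** G p = - (G p ** pd F a p ** G p)" by (simp add: mm.minus_left)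
    moreover have "F p ** G p = mat 1" using inv[OF p] by (simp add: matrix_left_right_inverse)
    ultimately show ?thesis by (simp add: matrix_mul_assoc[symmetric])
  qed
  have "pd R 1 p = - (P p ** R p) + G p ** pd (pd F \<i>) 1 p"
    unfolding R_def P_def using pd_bounded_bilinear[OF bounded_bilinear_matrix_mult d(2,4), of 1]
    by (simp add: dG mm.minus_left matrix_mul_assoc)
  moreover have "pd P \<i> p = - (R p ** P p) + G p ** pd (pd F 1) \<i> p"
    unfolding R_def P_def using pd_bounded_bilinear[OF bounded_bilinear_matrix_mult d(2,3), of \<i>]
    by (simp add: dG mm.minus_left matrix_mul_assoc)
  ultimately show ?thesis using pd_commute[OF D p F] by simp
qed

text \<open>The obstruction below is the coefficient of \<open>1/l\<close> in the curvature; by the Maurer-Cartan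
  equation the one of \<open>l\<close> is its negative and the one of \<open>1\<close> vanishes.\<close>

definition harmonicity :: "(complex \<Rightarrow> complex^4^4) \<Rightarrow> (complex \<Rightarrow> complex^4^4) \<Rightarrow> complex \<Rightarrow> complex^4^4" where
  "harmonicity P R p =
    (let U = (\<lambda>q. msc (1/2) (p_part (P q) - msc \<i> (p_part (R q)))); M = msc \<i> (k_part (P p)) - k_part (R p)
     in msc \<i> (pd U 1 p) - pd U \<i> p + (M ** U p - U p ** M))"

text \<open>\<open>U\<close> and \<open>V\<close> are the dz and dzbar coefficients of the p-part,
  whence the factors i and -i in \<open>B\<close>. In the curvature, the l^2 and l^(-2) terms are
  commutators of \<open>V\<close> and of \<open>U\<close> with their own multiples and
  vanish.\<close>

lemma flat_family_iff:
  fixes F G :: "complex \<Rightarrow> complex^4^4"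
  assumes D: "open D" and F: "Ck_on 2 D F" and G: "Ck_on 2 D G"
    and inv: "\<And>q. q \<in> D \<Longrightarrow> G q ** F q = mat 1"
  shows "(\<forall>l\<in>sphere 0 1. flat_connection_on D (assoc_form (maurer_cartan F) l)) \<longleftrightarrow>
    (\<forall>p\<in>D. harmonicity (\<lambda>q. G q ** pd F 1 q) (\<lambda>q. G q ** pd F \<i> q) p = 0)"
proof -
  define P where "P q = G q ** pd F 1 q" for q
  define R where "R q = G q ** pd F \<i> q" for q
  define U where "U q = msc (1/2) (p_part (P q) - msc \<i> (p_part (R q)))" for q
  define V where "V q = msc (1/2) (p_part (P q) + msc \<i> (p_part (R q)))" for q
  define E where "E p = harmonicity P R p" for p
  have minv: "matrix_inv (F q) = G q" if "q \<in> D" for q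
  proof -
    have FG: "F q ** G q = mat 1" using inv[OF that] by (simp add: matrix_left_right_inverse)
    then have "\<exists>X. F q ** X = mat 1 \<and> X ** F q = mat 1" using inv[OF that] by blast
    from someI_ex[OF this] have "F q ** matrix_inv (F q) = mat 1" unfolding matrix_inv_def by blast
    then have "G q ** F q ** matrix_inv (F q) = G q" by (simp add: matrix_mul_assoc[symmetric])
    then show ?thesis by (simp add: inv[OF that])
  qed
  have dF: "F differentiable at q" if "q \<in> D" for q using F that by (auto simp: numeral_2_eq_2)
  have mc: "maurer_cartan F q v = Re v *\<^sub>R P q + Im v *\<^sub>R R q" if "q \<in> D" for q v
    unfolding maurer_cartan_def minv[OF that] P_def R_def pd_directions[OF dF[OF that], of v]
    by (simp add: mm.add_right mm.scaleR_right)
  have dPR: "P differentiable at q" "R differentiable at q" if "q \<in> D" for q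
    unfolding P_def[abs_def] R_def[abs_def]
    using F G that by (auto simp: numeral_2_eq_2 intro!: differentiable_bounded_bilinear[OF bounded_bilinear_matrix_mult])
  define A where "A l q = msc (inverse l) (U q) + k_part (P q) + msc l (V q)" for l q
  define B where "B l q = msc (\<i> * inverse l) (U q) + k_part (R q) + msc (- \<i> * l) (V q)" for l q
  have form: "assoc_form (maurer_cartan F) l q v = Re v *\<^sub>R A l q + Im v *\<^sub>R B l q" if "q \<in> D" for l q v
    unfolding assoc_form_def form10_def form01_def mc[OF that] A_def B_def U_def V_def
    by (simp add: part_simps vec_eq_iff) (simp add: scaleR_conv_of_real algebra_simps)
  have Dl: "((\<lambda>q. L (X q)) has_derivative (\<lambda>a. L (pd X a p))) (at p)"
    if "bounded_linear L" "X differentiable at p" for X :: "complex \<Rightarrow> complex^4^4" and L :: "_ \<Rightarrow> complex^4^4" and p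
    using bounded_linear.has_derivative[OF that(1) has_derivative_pd[OF that(2)]] .
  have derU: "(U has_derivative (\<lambda>a. msc (1/2) (p_part (pd P a p) - msc \<i> (p_part (pd R a p))))) (at p)"
    and derV: "(V has_derivative (\<lambda>a. msc (1/2) (p_part (pd P a p) + msc \<i> (p_part (pd R a p))))) (at p)"
    if "p \<in> D" for p
    unfolding U_def[abs_def] V_def[abs_def]
    by (intro bounded_linear.has_derivative[OF bounded_linear_msc] has_derivative_diff has_derivative_add
      Dl bounded_linear_p_part dPR that)+
  have dUV: "U differentiable at p" "V differentiable at p" if "p \<in> D" for p
    using derU[OF that] derV[OF that] unfolding differentiable_def by blast+
  have derA: "(A l has_derivative (\<lambda>a. msc (inverse l) (pd U a p) + k_part (pd P a p) + msc l (pd V a p))) (at p)"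
    and derB: "(B l has_derivative (\<lambda>a. msc (\<i> * inverse l) (pd U a p) + k_part (pd R a p) + msc (- \<i> * l) (pd V a p))) (at p)"
    if "p \<in> D" for l p
    unfolding A_def[abs_def] B_def[abs_def]
    by (intro has_derivative_add Dl bounded_linear_msc bounded_linear_k_part dPR dUV that)+
  have flat: "flat_connection_on D (assoc_form (maurer_cartan F) l) \<longleftrightarrow>
      (\<forall>p\<in>D. pd (B l) 1 p - pd (A l) \<i> p + (A l p ** B l p - B l p ** A l p) = 0)" for l
    by (rule flat_connection_iff[OF D form]) (use derA derB differentiable_def in blast)+
  have curv: "pd (B l) 1 p - pd (A l) \<i> p + (A l p ** B l p - B l p ** A l p) = msc (inverse l - l) (E p)"
    if p: "p \<in> D" and l: "l \<noteq> 0" for l p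
  proof -
    note rules = mm.add_left mm.add_right mm.diff_left mm.diff_right mm.minus_left mm.minus_right msc_mult part_simps
    have MC: "pd R 1 p - pd P \<i> p + (P p ** R p - R p ** P p) = 0"
      using maurer_cartan_equation[OF D p F G inv] unfolding P_def R_def .
    define Ux where "Ux = pd U 1 p" define Uy where "Uy = pd U \<i> p"
    define Vx where "Vx = pd V 1 p" define Vy where "Vy = pd V \<i> p"
    define K where "K = k_part (P p)" define S where "S = k_part (R p)"
    define u where "u = U p" define v where "v = V p"
    have pp: "p_part (P p) = u + v" "p_part (R p) = msc \<i> (u - v)"
      by (simp_all add: u_def v_def U_def V_def vec_eq_iff algebra_simps)
    have pd_p: "p_part (pd R 1 p) = msc \<i> (Ux - Vx)" "p_part (pd P \<i> p) = Uy + Vy"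
      unfolding Ux_def Uy_def Vx_def Vy_def pd_eqI[OF derU[OF p]] pd_eqI[OF derV[OF p]]
      by (simp_all add: vec_eq_iff algebra_simps)
    \<comment> \<open>The Maurer-Cartan equation is split by the grading. Its k-part eliminates the
      derivative of \<open>k_part R\<close>, its p-part eliminates \<open>Vy\<close>; the remaining
      matrices are then independent symbols.\<close>
    have "k_part (pd R 1 p) - k_part (pd P \<i> p) + (K ** S - S ** K + (msc \<i> ((u + v) ** (u - v)) - msc \<i> ((u - v) ** (u + v)))) = 0"
      using arg_cong[OF MC, of k_part, unfolded part_simps k_part_mult, unfolded pp K_def[symmetric] S_def[symmetric] msc_mult]
      by (simp add: algebra_simps)
    then have k: "k_part (pd R 1 p) = k_part (pd P \<i> p) - (K ** S - S ** K) - msc 2 (msc \<i> (v ** u)) + msc 2 (msc \<i> (u ** v))"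
      by (simp add: rules vec_eq_iff algebra_simps)
    have "msc \<i> (Ux - Vx) - (Uy + Vy) + (K ** msc \<i> (u - v) + (u + v) ** S - (S ** (u + v) + msc \<i> (u - v) ** K)) = 0"
      using arg_cong[OF MC, of p_part, unfolded part_simps p_part_mult, unfolded pp pd_p K_def[symmetric] S_def[symmetric]]
      by (simp add: algebra_simps)
    then have Vy: "Vy = msc \<i> (Ux - Vx) - Uy + (msc \<i> (K ** (u - v)) + (u + v) ** S - (S ** (u + v) + msc \<i> ((u - v) ** K)))"
      unfolding msc_mult by (simp add: algebra_simps)
    have cancel: "l * (inverse l * x) = x" for x using l by (simp add: mult.assoc[symmetric])
    have Ep: "E p = msc \<i> Ux - Uy + ((msc \<i> K - S) ** u - u ** (msc \<i> K - S))"
      unfolding E_def harmonicity_def Let_def Ux_def Uy_def K_def S_def u_def U_def[abs_def] by simp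
    show ?thesis
      unfolding pd_eqI[OF derA[OF p]] pd_eqI[OF derB[OF p]] A_def B_def Ep
        Ux_def[symmetric] Uy_def[symmetric] Vx_def[symmetric] Vy_def[symmetric] u_def[symmetric] v_def[symmetric]
        K_def[symmetric] S_def[symmetric] k unfolding Vy
      by (simp add: rules vec_eq_iff) (simp add: algebra_simps cancel)
  qed
  show ?thesis unfolding P_def[symmetric] R_def[symmetric] E_def[symmetric]
  proof
    assume "\<forall>l\<in>sphere 0 1. flat_connection_on D (assoc_form (maurer_cartan F) l)"
    \<comment> \<open>At l = 1 and l = -1 the factor \<open>inverse l - l\<close> is zero and
      nothing is learned; at l = i it is -2i.\<close>
    then have "flat_connection_on D (assoc_form (maurer_cartan F) \<i>)" by simp
    then have "msc (inverse \<i> - \<i>) (E p) = 0" if "p \<in> D" for p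
      using that curv[OF that, of \<i>] unfolding flat by simp
    then have "E p = 0" if "p \<in> D" for p
      using that by (fastforce simp: vec_eq_iff)
    then show "\<forall>p\<in>D. E p = 0" by blast
  next
    assume 0: "\<forall>p\<in>D. E p = 0"
    show "\<forall>l\<in>sphere 0 1. flat_connection_on D (assoc_form (maurer_cartan F) l)"
    proof
      fix l :: complex assume "l \<in> sphere 0 1"
      then have "l \<noteq> 0" by auto
      then show "flat_connection_on D (assoc_form (maurer_cartan F) l)"
        unfolding flat using curv 0 by (simp add: part_simps)
    qed
  qed
qed

text \<open>The assumption \<open>vert\<close> says that the first two columns are parallel in the
  bundle they span. The off-diagonal obstruction is then the projection of their Laplacian to the
  complementary bundle.\<close>

lemma moving_frame_flat_iff:
  fixes c :: "4 \<Rightarrow> complex \<Rightarrow> complex^4"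
  defines "s \<equiv> \<lambda>i::4. if i \<in> {1, 2} then - 1 else 1 :: complex"
  assumes D: "open D" and C: "\<And>j. Ck_on 2 D (c j)"
    and orth: "\<And>q i j. q \<in> D \<Longrightarrow> bil (c i q) (c j q) = (if i = j then s i else 0)"
    and vert: "\<And>q i j a. q \<in> D \<Longrightarrow> i \<in> {1, 2} \<Longrightarrow> j \<in> {1, 2} \<Longrightarrow> bil (c i q) (pd (c j) a q) = 0"
  shows "(\<forall>l\<in>sphere 0 1. flat_connection_on D (assoc_form (maurer_cartan (\<lambda>q. \<chi> i j. c j q $ i)) l)) \<longleftrightarrow>
    (\<forall>p\<in>D. \<forall>i\<in>{3, 4}. \<forall>j\<in>{1, 2}. bil (c i p) (pd (pd (c j) 1) 1 p + pd (pd (c j) \<i>) \<i> p) = 0)"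
proof -
  define F :: "complex \<Rightarrow> complex^4^4" where "F q = (\<chi> i j. c j q $ i)" for q
  \<comment> \<open>\<open>T M\<close> is eta M^T eta with eta the signature matrix. On an
    orthonormal frame it is the inverse, and being linear it inherits the differentiability of the
    frame.\<close>
  define T :: "complex^4^4 \<Rightarrow> complex^4^4" where "T M = (\<chi> i j. s i * s j * M $ j $ i)" for M
  define G where "G q = T (F q)" for q
  define L :: "4 \<Rightarrow> complex^4 \<Rightarrow> complex^4^4" where "L j v = (\<chi> i k. if k = j then v $ i else 0)" for j v
  have bl: "bounded_linear (L j)" "bounded_linear T" for j
    unfolding linear_conv_bounded_linear[symmetric] L_def T_def
    by (auto intro!: linearI simp: vec_eq_iff algebra_simps)
  have "F = (\<lambda>q. L 1 (c 1 q) + L 2 (c 2 q) + L 3 (c 3 q) + L 4 (c 4 q))"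
    by (simp add: fun_eq_iff vec_eq_iff forall_4 F_def L_def)
  moreover have "Ck_on 2 D (\<lambda>q. L 1 (c 1 q) + L 2 (c 2 q) + L 3 (c 3 q) + L 4 (c 4 q))"
    by (intro Ck_on_add[OF D] Ck_on_bounded_linear[OF D bl(1)] C)
  ultimately have CF: "Ck_on 2 D F" by (simp only:)
  then have CG: "Ck_on 2 D G" unfolding G_def[abs_def] by (rule Ck_on_bounded_linear[OF D bl(2)])
  have s: "bil x y = (\<Sum>k\<in>UNIV. s k * x$k * y$k)" for x y
    by (simp add: bil_def sum_4 s_def)
  have ss: "s i * s i = 1" for i by (simp add: s_def)
  have GA: "(G q ** A) $ i $ j = s i * bil (c i q) (column j A)" for q A i j
    by (simp add: G_def T_def F_def matrix_matrix_mult_def s column_def sum_distrib_left algebra_simps)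
  have colF: "column j (F q) = c j q" for j q by (simp add: F_def column_def vec_eq_iff)
  have inv: "G q ** F q = mat 1" if "q \<in> D" for q
    by (simp add: vec_eq_iff GA colF orth[OF that] ss mat_def)
  have dF: "F differentiable at q" if "q \<in> D" for q using CF that by (auto simp: numeral_2_eq_2)
  have dc: "c j differentiable at q" "pd (c j) 1 differentiable at q" "pd (c j) \<i> differentiable at q" if "q \<in> D" for j q
    using C[of j] that by (auto simp: numeral_2_eq_2)
  have "bounded_linear (column j :: complex^4^4 \<Rightarrow> complex^4)" for j
    unfolding linear_conv_bounded_linear[symmetric] column_def by (auto intro!: linearI simp: vec_eq_iff)
  then have colpd: "column j (pd F a q) = pd (c j) a q" if "q \<in> D" for j a q
    using pd_bounded_linear[OF _ dF[OF that], of "column j" a] by (simp add: colF eta_contract_eq)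
  define P where "P q = G q ** pd F 1 q" for q
  define R where "R q = G q ** pd F \<i> q" for q
  have PR: "P q $ i $ j = s i * bil (c i q) (pd (c j) 1 q)" "R q $ i $ j = s i * bil (c i q) (pd (c j) \<i> q)"
    if "q \<in> D" for q i j
    by (simp_all add: P_def R_def GA colpd[OF that])
  have dPR: "P differentiable at q" "R differentiable at q" if "q \<in> D" for q
    unfolding P_def[abs_def] R_def[abs_def]
    using CF CG that by (auto simp: numeral_2_eq_2 intro!: differentiable_bounded_bilinear[OF bounded_bilinear_matrix_mult])
  define U where "U q = msc (1/2) (p_part (P q) - msc \<i> (p_part (R q)))" for q
  have skew: "bil (c i q) (pd (c j) a q) = - bil (pd (c i) a q) (c j q)" if "q \<in> D" for q i j a
  proof -
    have "pd (\<lambda>q. bil (c i q) (c j q)) a q = pd (\<lambda>q. if i = j then s i else 0) a q"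
      by (rule pd_cong[OF D that orth])
    then show ?thesis using dc(1)[OF that] by (simp add: pd_bil eq_neg_iff_add_eq_0 add.commute)
  qed
  \<comment> \<open>Twice the z-derivative of the column; \<open>m\<close> further below is 2i times
    a zbar-derivative.\<close>
  define w where "w j q = pd (c j) 1 q - \<i> *s pd (c j) \<i> q" for j q
  have U_nth: "U q $ i $ j = (if i \<in> {1,2} \<longleftrightarrow> j \<in> {1,2} then 0 else s i / 2 * bil (c i q) (w j q))" if "q \<in> D" for q i j
    by (cases "i \<in> {1,2} \<longleftrightarrow> j \<in> {1,2}")
      (simp_all add: U_def p_part_def PR[OF that] w_def bil.diff_right algebra_simps del: insert_iff)
  have U_sym: "U q $ j $ i = U q $ i $ j" if "q \<in> D" for q i j
  proof -
    have "bil (c i q) (w j q) = - bil (c j q) (w i q)"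
      unfolding w_def bil.diff_right bil_scale skew[OF that, of i j]
      by (simp add: bil_commute[of "pd (c i) a q" for a])
    then show ?thesis unfolding U_nth[OF that] by (auto simp: s_def)
  qed
  have dU: "U differentiable at q" if "q \<in> D" for q
    unfolding U_def[abs_def]
    by (rule differentiable_bounded_linear[OF bounded_linear_msc] differentiable_diff
      differentiable_bounded_linear[OF bounded_linear_p_part] dPR that)+
  have pdU: "pd U a q $ i $ j = pd (\<lambda>q. U q $ i $ j) a q" if "q \<in> D" for a q i j
    using pd_bounded_linear[OF bounded_linear_compose[OF bounded_linear_vec_nth bounded_linear_vec_nth] dU[OF that], of i j a] by simp
  have harm: "(harmonicity P R p = 0) \<longleftrightarrow>
    (\<forall>i\<in>{3, 4}. \<forall>j\<in>{1, 2}. bil (c i p) (pd (pd (c j) 1) 1 p + pd (pd (c j) \<i>) \<i> p) = 0)" if p: "p \<in> D" for p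
  proof -
    define M where "M = msc \<i> (k_part (P p)) - k_part (R p)"
    have H: "harmonicity P R p = msc \<i> (pd U 1 p) - pd U \<i> p + (M ** U p - U p ** M)"
      by (simp add: harmonicity_def M_def U_def[abs_def] Let_def)
    have M_nth: "M $ i $ j = (if i \<in> {1,2} \<longleftrightarrow> j \<in> {1,2} then s i * bil (c i p) (\<i> *s pd (c j) 1 p - pd (c j) \<i> p) else 0)" for i j
      by (cases "i \<in> {1,2} \<longleftrightarrow> j \<in> {1,2}")
        (simp_all add: M_def k_part_def PR[OF p] bil.diff_right algebra_simps del: insert_iff)
    have M_skew: "M $ j $ i = - M $ i $ j" for i j
    proof -
      have "bil (c i p) (\<i> *s pd (c j) 1 p - pd (c j) \<i> p) = - bil (c j p) (\<i> *s pd (c i) 1 p - pd (c i) \<i> p)"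
        unfolding bil.diff_right bil_scale skew[OF p, of i j]
        by (simp add: bil_commute[of "pd (c i) a p" for a])
      then show ?thesis unfolding M_nth by (auto simp: s_def)
    qed
    \<comment> \<open>\<open>U\<close> is symmetric because skewness meets opposite signs in the
      off-diagonal blocks, while \<open>M\<close> is skew. So their commutator is symmetric, and one
      off-diagonal block suffices.\<close>
    have H_sym: "harmonicity P R p $ j $ i = harmonicity P R p $ i $ j" for i j
    proof -
      have "pd U a p $ j $ i = pd U a p $ i $ j" for a
        unfolding pdU[OF p] by (rule pd_cong[OF D p U_sym])
      then show ?thesis unfolding H
        by (simp add: matrix_matrix_mult_def U_sym[OF p, of _ j] U_sym[OF p, of i] M_skew[of j] M_skew[of _ i] sum_negf mult.commute)
    qed
    have H_same: "harmonicity P R p $ i $ j = 0" if "i \<in> {1,2} \<longleftrightarrow> j \<in> {1,2}" for i j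
    proof -
      have "pd U a p $ i $ j = pd (\<lambda>q. 0) a p" for a
        unfolding pdU[OF p] by (rule pd_cong[OF D p]) (simp add: U_nth that del: insert_iff)
      moreover have "M $ i $ k * U p $ k $ j = 0" "U p $ i $ k * M $ k $ j = 0" for k
        using that by (auto simp: M_nth U_nth[OF p])
      then have "(M ** U p) $ i $ j = 0" "(U p ** M) $ i $ j = 0"
        by (simp_all only: matrix_matrix_mult_def vec_lambda_beta sum.neutral_const)
      ultimately show ?thesis unfolding H by simp
    qed
    have H_off: "harmonicity P R p $ i $ j = \<i> / 2 * bil (c i p) (pd (pd (c j) 1) 1 p + pd (pd (c j) \<i>) \<i> p)"
      if i: "i \<in> {3, 4}" and j: "j \<in> {1, 2}" for i j
    proof -
      define m where "m i = \<i> *s pd (c i) 1 p - pd (c i) \<i> p" for i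
      have dw: "w j differentiable at p" "pd (w j) a p = pd (pd (c j) 1) a p - \<i> *s pd (pd (c j) \<i>) a p" for a
      proof -
        have "(w j has_derivative (\<lambda>a. pd (pd (c j) 1) a p - \<i> *s pd (pd (c j) \<i>) a p)) (at p)"
          unfolding w_def[abs_def]
          by (intro has_derivative_diff has_derivative_pd dc p
              bounded_linear.has_derivative[OF bounded_bilinear.bounded_linear_right[OF bounded_bilinear_vec_scale]])
        then show "w j differentiable at p" "pd (w j) a p = pd (pd (c j) 1) a p - \<i> *s pd (pd (c j) \<i>) a p"
          by (auto simp: differentiable_def pd_eqI)
      qed
      have pdUij: "pd U a p $ i $ j = (bil (pd (c i) a p) (w j p) + bil (c i p) (pd (w j) a p)) / 2" for a
      proof -
        have "pd U a p $ i $ j = pd (\<lambda>q. 1/2 * bil (c i q) (w j q)) a p"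
          unfolding pdU[OF p] by (rule pd_cong[OF D p]) (use i j in \<open>auto simp: U_nth s_def\<close>)
        also have "\<dots> = 1/2 * (bil (pd (c i) a p) (w j p) + bil (c i p) (pd (w j) a p))"
          using pd_bounded_linear[OF bounded_linear_mult_right differentiable_bil[OF dc(1)[OF p] dw(1)], of "1/2" i a]
          by (simp add: pd_bil[OF dc(1)[OF p] dw(1)])
        finally show ?thesis by simp
      qed
      have vert_w: "bil (c k p) (w j p) = 0" if "k \<in> {1, 2}" for k
        using vert[OF p that j] by (simp add: w_def bil.diff_right)
      \<comment> \<open>Expansion in the frame itself; \<open>vert\<close> leaves only the last two
        columns, which is the sum that occurs in \<open>M ** U\<close>.\<close>
      have "bil (m i) (w j p) = (\<Sum>k\<in>UNIV. bil (m i) (s k *s c k p) * bil (c k p) (w j p))"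
        by (rule bil_dual_basis) (simp add: orth[OF p] ss mult.commute)
      then have compl: "bil (m i) (w j p) = bil (m i) (c 3 p) * bil (c 3 p) (w j p) + bil (m i) (c 4 p) * bil (c 4 p) (w j p)"
        using vert_w by (simp add: sum_4 s_def)
      have skm: "bil (c i p) (\<i> *s pd (c k) 1 p - pd (c k) \<i> p) = - bil (m i) (c k p)" for k
        by (simp add: m_def bil.diff_right bil.diff_left skew[OF p, of i k])
      have MU: "(M ** U p) $ i $ j = - bil (m i) (w j p) / 2"
        unfolding compl using i j by (auto simp: matrix_matrix_mult_def sum_4 M_nth U_nth[OF p] skm s_def add_divide_distrib)
      have "M $ k $ j = 0" if "k \<in> {1,2}" for k
        using vert[OF p that j] by (simp add: M_nth bil.diff_right)
      then have UM: "(U p ** M) $ i $ j = 0"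
        using i j by (auto simp: matrix_matrix_mult_def sum_4 U_nth[OF p])
      have "harmonicity P R p $ i $ j = \<i> * (bil (pd (c i) 1 p) (w j p) + bil (c i p) (pd (w j) 1 p)) / 2
         - (bil (pd (c i) \<i> p) (w j p) + bil (c i p) (pd (w j) \<i> p)) / 2 - bil (m i) (w j p) / 2"
        unfolding H by (simp add: pdUij MU UM)
      \<comment> \<open>The terms that differentiate column i add up to half the product of
        \<open>m i\<close> and \<open>w j p\<close>, which the commutator cancels.\<close>
      also have "\<dots> = (\<i> * bil (c i p) (pd (w j) 1 p) - bil (c i p) (pd (w j) \<i> p)) / 2"
        unfolding m_def bil.diff_left bil_scale by (simp add: field_simps)
      also have "\<dots> = \<i> / 2 * bil (c i p) (pd (pd (c j) 1) 1 p + pd (pd (c j) \<i>) \<i> p)"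
        unfolding dw(2) pd_commute[OF D p C] by (simp add: bil.diff_right bil.add_right field_simps)
      finally show ?thesis .
    qed
    show ?thesis
    proof
      assume "harmonicity P R p = 0"
      then show "\<forall>i\<in>{3, 4}. \<forall>j\<in>{1, 2}. bil (c i p) (pd (pd (c j) 1) 1 p + pd (pd (c j) \<i>) \<i> p) = 0"
        using H_off by fastforce
    next
      assume 0: "\<forall>i\<in>{3, 4}. \<forall>j\<in>{1, 2}. bil (c i p) (pd (pd (c j) 1) 1 p + pd (pd (c j) \<i>) \<i> p) = 0"
      have off: "harmonicity P R p $ i $ j = 0" if "i \<in> {3, 4}" "j \<in> {1, 2}" for i j
      proof -
        have "bil (c i p) (pd (pd (c j) 1) 1 p + pd (pd (c j) \<i>) \<i> p) = 0" using 0 that by blast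
        then show ?thesis unfolding H_off[OF that] by simp
      qed
      have "harmonicity P R p $ i $ j = 0" for i j
      proof (cases "i \<in> {1,2} \<longleftrightarrow> j \<in> {1,2}")
        case False
        then consider "i \<in> {3,4}" "j \<in> {1,2}" | "j \<in> {3,4}" "i \<in> {1,2}"
          using exhaust_4[of i] exhaust_4[of j] by auto
        then show ?thesis using off[of i j] off[of j i] H_sym[of i j] by cases auto
      qed (rule H_same)
      then show "harmonicity P R p = 0" by (simp add: vec_eq_iff)
    qed
  qed
  have "(\<forall>l\<in>sphere 0 1. flat_connection_on D (assoc_form (maurer_cartan F) l)) \<longleftrightarrow>
      (\<forall>p\<in>D. harmonicity P R p = 0)"
    using flat_family_iff[OF D CF CG inv] unfolding P_def[abs_def] R_def[abs_def] .
  also have "\<dots> \<longleftrightarrow>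
      (\<forall>p\<in>D. \<forall>i\<in>{3, 4}. \<forall>j\<in>{1, 2}. bil (c i p) (pd (pd (c j) 1) 1 p + pd (pd (c j) \<i>) \<i> p) = 0)"
    by (intro ball_cong harm refl)
  finally show ?thesis unfolding F_def[abs_def] .
qed

section \<open>The given frame as an orthonormal moving frame\<close>

context lagrangian_lift
begin

definition re_column :: "complex^4 \<Rightarrow> complex^4" where
  "re_column v = of_real (1 / sqrt 2) *s (v + vcnj v)"

definition im_column :: "complex^4 \<Rightarrow> complex^4" where
  "im_column v = (- \<i> * of_real (1 / sqrt 2)) *s (v - vcnj v)"

definition frame_r :: "complex \<Rightarrow> real" where
  "frame_r q = 2 * exp (u q) + 2 * Re (alpha h q)"

definition frame_s :: "complex \<Rightarrow> real" where
  "frame_s q = exp (2 * u q) - (cmod (alpha h q))\<^sup>2"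

definition column3 :: "complex \<Rightarrow> complex^4" where
  "column3 q = of_real (1 / sqrt (frame_r q)) *s (wirt_z h q + vcnj (wirt_z h q))"

definition column4 :: "complex \<Rightarrow> complex^4" where
  "column4 q = (- \<i> * of_real (1 / sqrt (frame_r q * frame_s q))) *s
     ((of_real (exp (u q)) + cnj (alpha h q)) *s wirt_z h q - (of_real (exp (u q)) + alpha h q) *s vcnj (wirt_z h q))"

definition frame_column :: "4 \<Rightarrow> complex \<Rightarrow> complex^4" where
  "frame_column j q = (if j = 1 then re_column (h q) else if j = 2 then im_column (h q) else if j = 3 then column3 q else column4 q)"

lemma frame_eq: "frame u h = (\<lambda>q. \<chi> i j. frame_column j q $ i)"
  by (simp add: fun_eq_iff vec_eq_iff frame_def Let_def frame_column_def re_column_def im_column_def column3_def column4_def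
      frame_r_def frame_s_def)

lemma bounded_linear_parts: "bounded_linear re_column" "bounded_linear im_column"
  unfolding re_column_def[abs_def] im_column_def[abs_def]
  by (intro bounded_linear_compose[OF bounded_bilinear.bounded_linear_right[OF bounded_bilinear_vec_scale]]
      bounded_linear_add bounded_linear_sub bounded_linear_ident bounded_linear_vcnj)+

lemma frame_r_pos: "q \<in> D \<Longrightarrow> frame_r q > 0"
  using alpha_less[of q] abs_Re_le_cmod[of "alpha h q"] by (simp add: frame_r_def)

lemma frame_s_pos: "q \<in> D \<Longrightarrow> frame_s q > 0"
  using alpha_bound by (simp add: frame_s_def)

lemma wirt_products:
  assumes q: "q \<in> D"
  shows "bil (wirt_z h q) (vcnj (wirt_z h q)) = of_real (exp (u q))"
    "bil (h q) (wirt_z h q) = 0" "bil (vcnj (h q)) (wirt_z h q) = 0"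
    "bil (h q) (vcnj (wirt_z h q)) = 0" "bil (vcnj (h q)) (vcnj (wirt_z h q)) = 0"
proof -
  interpret adapted_basis "h q" "hx q" "hy q" "of_real (2 * exp (u q))" by (rule basis[OF q])
  show "bil (wirt_z h q) (vcnj (wirt_z h q)) = of_real (exp (u q))"
    "bil (h q) (wirt_z h q) = 0" "bil (vcnj (h q)) (wirt_z h q) = 0"
    "bil (h q) (vcnj (wirt_z h q)) = 0" "bil (vcnj (h q)) (vcnj (wirt_z h q)) = 0"
    unfolding wirt_z_def
    by (simp_all add: bil.add_left bil.add_right bil.diff_left bil.diff_right rules)
qed

text \<open>\<open>frame_r\<close> is the square of \<open>X + vcnj X\<close>. The combination in
  column 4 is orthogonal to it and has square \<open>- frame_r q * frame_s q\<close>, the sign being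
  compensated by the factor -i.\<close>

lemma frame_column_orthonormal:
  assumes q: "q \<in> D"
  shows "bil (frame_column i q) (frame_column j q) = (if i = j then if i \<in> {1, 2} then - 1 else 1 else 0)"
proof -
  interpret adapted_basis "h q" "hx q" "hy q" "of_real (2 * exp (u q))" by (rule basis[OF q])
  define X where "X = wirt_z h q"
  define e where "e = complex_of_real (exp (u q))"
  define A where "A = alpha h q"
  define k where "k = complex_of_real (1 / sqrt 2)"
  define t where "t = complex_of_real (1 / sqrt (frame_r q))"
  define v where "v = complex_of_real (1 / sqrt (frame_r q * frame_s q))"
  have sq: "of_real (1 / sqrt x) * (of_real (1 / sqrt x) * complex_of_real x) = 1" if "x > 0" for x
    using that by (simp flip: of_real_mult)
  have k: "k * (k * 2) = 1" using sq[of 2] by (simp add: k_def)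
  have r: "complex_of_real (frame_r q) = 2 * e + A + cnj A"
    by (simp add: frame_r_def e_def A_def complex_eq_iff)
  have s: "complex_of_real (frame_s q) = e * e - A * cnj A"
    unfolding frame_s_def e_def A_def of_real_diff complex_norm_square
    by (simp add: exp_double power2_eq_square)
  have t: "t * (t * (2 * e + A + cnj A)) = 1"
    using sq[OF frame_r_pos[OF q]] r by (simp add: t_def)
  have v: "v * (v * ((2 * e + A + cnj A) * (e * e - A * cnj A))) = 1"
    using sq[of "frame_r q * frame_s q"] frame_r_pos[OF q] frame_s_pos[OF q] r s by (simp add: v_def)
  have X: "bil X X = A" "bil (vcnj X) (vcnj X) = cnj A" "bil X (vcnj X) = e" "bil (vcnj X) X = e"
    using wirt_products(1)[OF q] by (simp_all add: X_def A_def e_def alpha_def bil_commute)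
  note hX = wirt_products(2-)[OF q, folded X_def]
  have c: "frame_column 1 q = k *s (h q + vcnj (h q))" "frame_column 2 q = (- \<i> * k) *s (h q - vcnj (h q))"
    "frame_column 3 q = t *s (X + vcnj X)" "frame_column 4 q = (- \<i> * v) *s ((e + cnj A) *s X - (e + A) *s vcnj X)"
    by (simp_all add: frame_column_def re_column_def im_column_def column3_def column4_def k_def t_def v_def X_def e_def A_def)
  have 33: "bil (frame_column 3 q) (frame_column 3 q) = t * (t * (2 * e + A + cnj A))"
    unfolding c bil_scale bil.add_left bil.add_right X by (simp add: algebra_simps)
  have 44: "bil (frame_column 4 q) (frame_column 4 q) = v * (v * ((2 * e + A + cnj A) * (e * e - A * cnj A)))"
    unfolding c bil_scale bil.diff_left bil.diff_right X by (simp add: algebra_simps)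
  have 34: "bil (frame_column 3 q) (frame_column 4 q) = 0"
    unfolding c bil_scale bil.add_left bil.diff_right X by (simp add: algebra_simps)
  have 11: "bil (frame_column 1 q) (frame_column 1 q) = - (k * (k * 2))"
    "bil (frame_column 2 q) (frame_column 2 q) = - (k * (k * 2))"
    "bil (frame_column 1 q) (frame_column 2 q) = 0"
    unfolding c by (simp_all add: bil.add_left bil.add_right bil.diff_left bil.diff_right rules algebra_simps)
  have 13: "bil (frame_column i q) (frame_column j q) = 0" if "i \<in> {1, 2}" "j \<in> {3, 4}" for i j
    using that
    by (elim insertE emptyE; simp only: c bil_scale bil.add_left bil.add_right bil.diff_left bil.diff_right hX; simp)
  have "\<forall>i j. bil (frame_column i q) (frame_column j q) = (if i = j then if i \<in> {1, 2} then - 1 else 1 else 0)"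
    unfolding forall_4 using 33 44 34 11 13 k t v
      bil_commute[of "frame_column 4 q" "frame_column 3 q"] bil_commute[of "frame_column 2 q" "frame_column 1 q"]
      bil_commute[of "frame_column 3 q" "frame_column 1 q"] bil_commute[of "frame_column 4 q" "frame_column 1 q"]
      bil_commute[of "frame_column 3 q" "frame_column 2 q"] bil_commute[of "frame_column 4 q" "frame_column 2 q"]
    by simp
  then show ?thesis by blast
qed

lemma pd_frame_column:
  assumes "q \<in> D"
  shows "pd (frame_column 1) a q = re_column (pd h a q)" "pd (frame_column 2) a q = im_column (pd h a q)"
  using pd_bounded_linear[OF bounded_linear_parts(1) h_differentiable[OF assms], of a]
    pd_bounded_linear[OF bounded_linear_parts(2) h_differentiable[OF assms], of a]
  by (simp_all add: frame_column_def[abs_def])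

lemma pd_pd_frame_column:
  assumes "q \<in> D" "b \<in> {1, \<i>}"
  shows "pd (pd (frame_column 1) b) a q = re_column (pd (pd h b) a q)"
    "pd (pd (frame_column 2) b) a q = im_column (pd (pd h b) a q)"
proof -
  have d: "pd h b differentiable at q" using assms by auto
  have "pd (pd (frame_column 1) b) a q = pd (\<lambda>q. re_column (pd h b q)) a q"
    by (rule pd_cong_D[OF assms(1) pd_frame_column(1)])
  then show "pd (pd (frame_column 1) b) a q = re_column (pd (pd h b) a q)"
    using pd_bounded_linear[OF bounded_linear_parts(1) d] by simp
  have "pd (pd (frame_column 2) b) a q = pd (\<lambda>q. im_column (pd h b q)) a q"
    by (rule pd_cong_D[OF assms(1) pd_frame_column(2)])
  then show "pd (pd (frame_column 2) b) a q = im_column (pd (pd h b) a q)"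
    using pd_bounded_linear[OF bounded_linear_parts(2) d] by simp
qed

lemma frame_column_vertical:
  assumes "q \<in> D" "i \<in> {1, 2}" "j \<in> {1, 2}"
  shows "bil (frame_column i q) (pd (frame_column j) a q) = 0"
proof -
  have 1: "bil (pd h a q) (h q) = 0" "bil (pd h a q) (vcnj (h q)) = 0"
    using pd_h_null pd_h_horizontal assms(1) by auto
  then have "bil (vcnj (pd h a q)) (vcnj (h q)) = 0" "bil (vcnj (pd h a q)) (h q) = 0"
    by (metis cnj_bil complex_cnj_zero vcnj_vcnj)+
  then have "bil (h q) (pd h a q) = 0" "bil (vcnj (h q)) (pd h a q) = 0"
    "bil (h q) (vcnj (pd h a q)) = 0" "bil (vcnj (h q)) (vcnj (pd h a q)) = 0"
    using 1 by (simp_all add: bil_commute)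
  then show ?thesis
    using assms pd_frame_column[OF assms(1), of a]
    by (auto simp: frame_column_def re_column_def im_column_def bil.add_left bil.add_right bil.diff_left bil.diff_right)
qed

lemma Ck_frame_column: "Ck_on k D (frame_column j)"
proof -
  note D' = D(1)
  have vs: "Ck_on k D (\<lambda>q. f q *s g q)" if "Ck_on k D f" "Ck_on k D g" for f and g :: "complex \<Rightarrow> complex^4"
    using Ck_on_bounded_bilinear[OF D' bounded_bilinear_vec_scale that] .
  have bl: "Ck_on k D (\<lambda>q. bil (f q) (g q))" if "Ck_on k D f" "Ck_on k D g" for f g
    using Ck_on_bounded_bilinear[OF D' bounded_bilinear_bil that] .
  have vc: "Ck_on k D (\<lambda>q. vcnj (f q))" if "Ck_on k D f" for f :: "complex \<Rightarrow> complex^4"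
    using Ck_on_bounded_linear[OF D' bounded_linear_vcnj that] .
  have mult: "Ck_on k D (\<lambda>q. f q * g q)" if "Ck_on k D f" "Ck_on k D g" for f g :: "complex \<Rightarrow> 'b::real_normed_algebra"
    using Ck_on_bounded_bilinear[OF D' bounded_bilinear_mult that] .
  have re: "Ck_on k D (\<lambda>q. Re (f q))" "Ck_on k D (\<lambda>q. cnj (f q))" if "Ck_on k D f" for f
    using Ck_on_bounded_linear[OF D' bounded_linear_Re that] Ck_on_bounded_linear[OF D' bounded_linear_cnj that] .
  have of_real: "Ck_on k D (\<lambda>q. complex_of_real (f q))" if "Ck_on k D f" for f
    using Ck_on_bounded_linear[OF D' bounded_linear_of_real that] .
  have X: "Ck_on k D (wirt_z h)"
    unfolding wirt_z_def[abs_def] by (intro vs Ck_on_const Ck_on_diff[OF D'] Ck)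
  have alpha: "Ck_on k D (alpha h)" unfolding alpha_def[abs_def] by (intro bl X)
  \<comment> \<open>Differentiability of \<open>u\<close> is not among the assumptions; it is
    recovered from the Hermitian square of h_z, which is e^u.\<close>
  have expu: "Ck_on k D (\<lambda>q. exp (u q))"
  proof (rule Ck_on_cong[OF D'])
    show "Re (bil (wirt_z h q) (vcnj (wirt_z h q))) = exp (u q)" if "q \<in> D" for q
      using wirt_products(1)[OF that] by simp
    show "Ck_on k D (\<lambda>q. Re (bil (wirt_z h q) (vcnj (wirt_z h q))))"
      by (intro re bl vc X)
  qed
  have r: "Ck_on k D frame_r"
    unfolding frame_r_def[abs_def] by (intro Ck_on_add[OF D'] mult Ck_on_const expu re alpha)
  have "frame_s = (\<lambda>q. exp (u q) * exp (u q) - Re (alpha h q * cnj (alpha h q)))"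
    by (rule ext) (simp add: frame_s_def exp_double power2_eq_square cmod_power2[unfolded power2_eq_square])
  moreover have "Ck_on k D (\<lambda>q. exp (u q) * exp (u q) - Re (alpha h q * cnj (alpha h q)))"
    by (intro Ck_on_diff[OF D'] mult expu re alpha)
  ultimately have s: "Ck_on k D frame_s" by (simp only:)
  have inv: "Ck_on k D (\<lambda>q. 1 / sqrt (frame_r q))" "Ck_on k D (\<lambda>q. 1 / sqrt (frame_r q * frame_s q))"
    using frame_r_pos frame_s_pos by (auto intro!: Ck_on_inverse_sqrt[OF D'] r s mult)
  have 12: "Ck_on k D (\<lambda>q. re_column (h q))" "Ck_on k D (\<lambda>q. im_column (h q))"
    using Ck_on_bounded_linear[OF D' bounded_linear_parts(1) Ck(1)]
      Ck_on_bounded_linear[OF D' bounded_linear_parts(2) Ck(1)] .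
  have 3: "Ck_on k D column3"
    unfolding column3_def[abs_def] by (intro vs of_real inv Ck_on_add[OF D'] X vc)
  have 4: "Ck_on k D column4"
    unfolding column4_def[abs_def]
    by (intro vs mult of_real inv Ck_on_add[OF D'] Ck_on_diff[OF D'] Ck_on_const X vc expu alpha re)
  show ?thesis
    unfolding frame_column_def[abs_def] using 12 3 4 by (cases "j = 1"; cases "j = 2"; cases "j = 3") simp_all
qed

lemma frame_column_real: "vcnj (frame_column j q) = frame_column j q"
  by (simp add: frame_column_def re_column_def im_column_def column3_def column4_def vec_eq_iff algebra_simps)

text \<open>Columns 1 and 2 are, up to a constant, the real and imaginary parts of h, so their
  Laplacians are those parts of \<open>lap\<close>. Tested against columns 3 and 4, they amount to
  the component of \<open>lap\<close> orthogonal to W.\<close>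

lemma flat_iff_lap:
  "(\<forall>l\<in>sphere 0 1. flat_connection_on D (assoc_form (maurer_cartan (frame u h)) l)) \<longleftrightarrow>
    (\<forall>p\<in>D. bil (lap p) (vcnj (hx p)) = 0 \<and> bil (lap p) (vcnj (hy p)) = 0)"
proof -
  have "(\<forall>l\<in>sphere 0 1. flat_connection_on D (assoc_form (maurer_cartan (frame u h)) l)) \<longleftrightarrow>
    (\<forall>p\<in>D. \<forall>i\<in>{3, 4}. \<forall>j\<in>{1, 2}.
       bil (frame_column i p) (pd (pd (frame_column j) 1) 1 p + pd (pd (frame_column j) \<i>) \<i> p) = 0)"
    unfolding frame_eq
    by (rule moving_frame_flat_iff[OF D(1) Ck_frame_column frame_column_orthonormal frame_column_vertical])
  also have "\<dots> \<longleftrightarrow> (\<forall>p\<in>D. bil (lap p) (vcnj (hx p)) = 0 \<and> bil (lap p) (vcnj (hy p)) = 0)"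
  proof (rule ball_cong[OF refl])
    fix p assume p: "p \<in> D"
    interpret adapted_basis "h p" "hx p" "hy p" "of_real (2 * exp (u p))" by (rule basis[OF p])
    have lap: "pd (pd (frame_column 1) 1) 1 p + pd (pd (frame_column 1) \<i>) \<i> p = re_column (lap p)"
      "pd (pd (frame_column 2) 1) 1 p + pd (pd (frame_column 2) \<i>) \<i> p = im_column (lap p)"
      using pd_pd_frame_column[OF p] linear_simps(1)[OF bounded_linear_parts(1)] linear_simps(1)[OF bounded_linear_parts(2)]
      by (simp_all add: lap_def)
    have conj: "bil (frame_column i p) (vcnj w) = cnj (bil (frame_column i p) w)" for i w
      by (simp add: frame_column_real)
    have "(\<forall>i\<in>{3, 4}. \<forall>j\<in>{1, 2}.
       bil (frame_column i p) (pd (pd (frame_column j) 1) 1 p + pd (pd (frame_column j) \<i>) \<i> p) = 0)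
      \<longleftrightarrow> (\<forall>i\<in>{3, 4}. bil (frame_column i p) (lap p) = 0)"
    proof (rule ball_cong[OF refl])
      fix i :: 4
      \<comment> \<open>The frame columns are real, so the two products are multiples of the real
        and the imaginary part of one complex number.\<close>
      have "bil (frame_column i p) (re_column (lap p)) = 0 \<and> bil (frame_column i p) (im_column (lap p)) = 0
        \<longleftrightarrow> bil (frame_column i p) (lap p) = 0"
        unfolding re_column_def im_column_def bil_scale bil.add_right bil.diff_right conj
        by (auto simp: complex_eq_iff simp del: cnj_bil)
      then show "(\<forall>j\<in>{1, 2}. bil (frame_column i p)
          (pd (pd (frame_column j) 1) 1 p + pd (pd (frame_column j) \<i>) \<i> p) = 0)
        \<longleftrightarrow> bil (frame_column i p) (lap p) = 0"
        by (simp only: ball_simps lap simp_thms)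
    qed
    \<comment> \<open>Columns 3 and 4 on one side, the conjugates of h_x and h_y on the other, span
      the same complement of W. Each direction expands the pairing with a vector of this complement
      in the respective basis.\<close>
    also have "\<dots> \<longleftrightarrow> bil (lap p) (vcnj (hx p)) = 0 \<and> bil (lap p) (vcnj (hy p)) = 0"
    proof
      assume 0: "bil (lap p) (vcnj (hx p)) = 0 \<and> bil (lap p) (vcnj (hy p)) = 0"
      have "bil (lap p) w = 0" if "bil (h p) w = 0" "bil (vcnj (h p)) w = 0" for w
        using completeness[of "lap p" w] 0 that by simp
      moreover have "bil (h p) (frame_column i p) = 0" "bil (vcnj (h p)) (frame_column i p) = 0" if "i \<in> {3, 4}" for i
        using that wirt_products[OF p]
        by (auto simp: frame_column_def column3_def column4_def bil.add_right bil.diff_right bil.minus_right)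
      ultimately show "\<forall>i\<in>{3, 4}. bil (frame_column i p) (lap p) = 0" by (metis bil_commute)
    next
      assume 0: "\<forall>i\<in>{3, 4}. bil (frame_column i p) (lap p) = 0"
      have "bil (lap p) w = 0" if w: "bil (h p) w = 0" "bil (vcnj (h p)) w = 0" for w
      proof -
        let ?s = "\<lambda>k::4. if k \<in> {1, 2} then - 1 else 1 :: complex"
        have "bil (lap p) w = (\<Sum>k\<in>UNIV. bil (lap p) (?s k *s frame_column k p) * bil (frame_column k p) w)"
          by (rule bil_dual_basis) (simp add: frame_column_orthonormal[OF p])
        moreover have "bil (frame_column 1 p) w = 0" "bil (frame_column 2 p) w = 0"
          using w by (simp_all add: frame_column_def re_column_def im_column_def bil.add_left bil.diff_left)
        moreover have "bil (lap p) (frame_column 3 p) = 0" "bil (lap p) (frame_column 4 p) = 0"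
          using 0 by (simp_all add: bil_commute)
        ultimately show ?thesis by (simp add: sum_4)
      qed
      then show "bil (lap p) (vcnj (hx p)) = 0 \<and> bil (lap p) (vcnj (hy p)) = 0" by (simp add: rules)
    qed
    finally show "(\<forall>i\<in>{3, 4}. \<forall>j\<in>{1, 2}.
       bil (frame_column i p) (pd (pd (frame_column j) 1) 1 p + pd (pd (frame_column j) \<i>) \<i> p) = 0)
      \<longleftrightarrow> bil (lap p) (vcnj (hx p)) = 0 \<and> bil (lap p) (vcnj (hy p)) = 0" .
  qed
  finally show ?thesis .
qed

end

theorem theorem1p3:
  fixes D :: "complex set" and Q :: "(complex^4) set set"
    and f :: "complex \<Rightarrow> (complex^4) set" and h :: "complex \<Rightarrow> complex^4"
    and u :: "complex \<Rightarrow> real"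
  assumes "open D" and "D \<noteq> {}" and "simply_connected D"
    and "is_Q2star Q"
    and "f ` D \<subseteq> Q"
    and "immersion_on D f"
    and "conformal_with D f u"
    and "lagrangian_on D f"
    and "horizontal_lift D f h"
    and "\<forall>z\<in>D. exp (2 * u z) - (cmod (alpha h z))\<^sup>2 > 0"
  shows "(minimal_on D f \<longleftrightarrow>
           (\<forall>l\<in>sphere 0 1. flat_connection_on D (assoc_form (maurer_cartan (frame u h)) l)))
       \<and> ((\<forall>l\<in>sphere 0 1. flat_connection_on D (assoc_form (maurer_cartan (frame u h)) l)) \<longleftrightarrow>
           (alpha h holomorphic_on D \<and> (\<exists>c. \<forall>z\<in>D. Arg (beta h z) = c)))"
proof -
  have "Q \<subseteq> null_quadric"
    using assms(4) connected_components_of_subset[of Q "subtopology CP3_topology null_quadric"]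
    unfolding is_Q2star_def by auto
  then interpret lagrangian_lift D f h u
    using assms by unfold_locales (auto intro: simply_connected_imp_connected)
  show ?thesis
    unfolding minimal_iff_lap flat_iff_lap
    using lap_eq_zero_iff_constant_arg lap_zero_imp_holomorphic by blast
qed

end
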